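(* Let $a,b,c,u,v,x,y,q$ be indeterminates and let $\mathbf J=[J_{n,k}]_{n,k\ge0}$ be defined by $J_{0,0}=1$, $J_{n,k}=0$ unless $0\le k\le n$, and $J_{n,k}=\delta_{k-1}J_{n-1,k-1}+\gamma_kJ_{n-1,k}+\beta_{k+1}J_{n-1,k+1}$ ($n\ge1$), with $\delta_k=(ak+a+b)(ku+u+v)$, $\gamma_k=(ax+cu)k^2+(ay+bx+cv+2cu)k+by+cv+cu$, $\beta_{k+1}=c[y+x(k+1)](k+1)$. Let $J_n(q)=\sum_kJ_{n,k}q^k$ and $J_n^*(q)=q^nJ_n(1/q)$. Then: (i) the binomial row-generating matrix $\mathbf J\mathbf B_q$ is coefficientwise totally positive in $(a,b,c,u,v,x,y,q)$; (ii) both $(J_n(q))_{n\ge0}$ and $(J_n^*(q))_{n\ge0}$ are coefficientwise Hankel-totally positive in $(a,b,c,u,v,x,y,q)$ and $3$-$(a,b,c,u,v,x,y,q)$-log-convex; (iii) $(J_{n,0})_{n\ge0}$ is coefficientwise Hankel-totally positive in $(a,b,c,u,v,x,y)$ and $3$-$(a,b,c,u,v,x,y)$-log-convex; (iv) for all real $a,b,c,u,v,x,y\ge0$, the convolution $r_n=\sum_kJ_{n,k}s_kt_{n-k}$ preserves the Stieltjes moment property.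
   Context: $\mathbf B_q=[\binom nkq^{n-k}]_{n,k\ge0}$. Coefficientwise total positivity: all minors are polynomials with nonnegative coefficients; coefficientwise Hankel-total positivity of $(a_n)$: same for $[a_{i+j}]$. $3$-$\mathbf z$-log-convexity of polynomials $(a_n)$: with $\mathcal L[a_i]=a_{i-1}a_{i+1}-a_i^2$ and $\mathcal L^k=\mathcal L(\mathcal L^{k-1})$, $\mathcal L^k[a_i]$ has nonnegative coefficients for $k\le3$. A convolution $r_n=\sum_k c_{n,k}s_kt_{n-k}$ preserves the Stieltjes moment property if $(r_n)$ is a Stieltjes moment sequence (moments $\int_0^\infty x^nd\mu$ of a nonnegative measure) whenever $(s_n),(t_n)$ are. *)

theory Defs
  imports
    "HOL-Library.Poly_Mapping"
    "HOL-Analysis.Analysis"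
    "Jordan_Normal_Form.Determinant"
begin

type_synonym 'v mpol = "('v \<Rightarrow>\<^sub>0 nat) \<Rightarrow>\<^sub>0 real"

definition indet :: "'v \<Rightarrow> 'v mpol" where
  "indet v = Poly_Mapping.single (Poly_Mapping.single v 1) 1"

definition nonneg_coeffs :: "'v mpol \<Rightarrow> bool" where
  "nonneg_coeffs p \<longleftrightarrow> (\<forall>m. 0 \<le> Poly_Mapping.lookup p m)"

text \<open>Infinite matrices are functions of two indices. The minor of order \<open>m\<close> uses the rows
  \<open>r 0 < \<dots> < r (m - 1)\<close> and the columns \<open>s 0 < \<dots> < s (m - 1)\<close>.\<close>

definition matrix_minor ::
  "(nat \<Rightarrow> nat \<Rightarrow> 'a::comm_ring_1) \<Rightarrow> nat \<Rightarrow> (nat \<Rightarrow> nat) \<Rightarrow> (nat \<Rightarrow> nat) \<Rightarrow> 'a" where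
  "matrix_minor M m r s = Determinant.det (Matrix.mat m m (\<lambda>(i, j). M (r i) (s j)))"

definition coeff_totally_positive :: "(nat \<Rightarrow> nat \<Rightarrow> 'v mpol) \<Rightarrow> bool" where
  "coeff_totally_positive M \<longleftrightarrow>
     (\<forall>m r s. strict_mono_on {..<m} r \<longrightarrow> strict_mono_on {..<m} s \<longrightarrow>
        nonneg_coeffs (matrix_minor M m r s))"

definition coeff_hankel_totally_positive :: "(nat \<Rightarrow> 'v mpol) \<Rightarrow> bool" where
  "coeff_hankel_totally_positive f \<longleftrightarrow> coeff_totally_positive (\<lambda>i j. f (i + j))"

text \<open>For a sequence indexed from \<open>0\<close>, \<open>(L ^^ k) f i\<close> is meaningful only for \<open>i \<ge> k\<close>: at smaller
  indices the truncated \<open>i - 1\<close> intervenes. Hence the bound on \<open>i\<close> in the next definition.\<close>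

definition log_convex_op :: "(nat \<Rightarrow> 'a::comm_ring_1) \<Rightarrow> nat \<Rightarrow> 'a" where
  "log_convex_op f i = f (i - 1) * f (i + 1) - (f i)\<^sup>2"

definition coeff_log_convex :: "nat \<Rightarrow> (nat \<Rightarrow> 'v mpol) \<Rightarrow> bool" where
  "coeff_log_convex r f \<longleftrightarrow> (\<forall>k\<le>r. \<forall>i\<ge>k. nonneg_coeffs ((log_convex_op ^^ k) f i))"

definition stieltjes_moment_seq :: "(nat \<Rightarrow> real) \<Rightarrow> bool" where
  "stieltjes_moment_seq f \<longleftrightarrow>
     (\<exists>\<mu> :: real measure. sets \<mu> = sets borel \<and>
        (\<forall>n. set_integrable \<mu> {0..} (\<lambda>x. x ^ n) \<and>
             f n = set_lebesgue_integral \<mu> {0..} (\<lambda>x. x ^ n)))"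

definition preserves_stieltjes :: "(nat \<Rightarrow> nat \<Rightarrow> real) \<Rightarrow> bool" where
  "preserves_stieltjes C \<longleftrightarrow>
     (\<forall>s t. stieltjes_moment_seq s \<longrightarrow> stieltjes_moment_seq t \<longrightarrow>
        stieltjes_moment_seq (\<lambda>n. \<Sum>k\<le>n. C n k * s k * t (n - k)))"

text \<open>The seven parameters of the recurrence as a record, so that the same matrix can be formed
  over polynomial rings and over the reals.\<close>

record 'a params =
  pa :: 'a
  pb :: 'a
  pc :: 'a
  pu :: 'a
  pv :: 'a
  px :: 'a
  py :: 'a

definition J_delta :: "('a::comm_semiring_1) params \<Rightarrow> nat \<Rightarrow> 'a" where
  "J_delta P k = (pa P * of_nat k + pa P + pb P) * (of_nat k * pu P + pu P + pv P)"

definition J_gamma :: "('a::comm_semiring_1) params \<Rightarrow> nat \<Rightarrow> 'a" where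
  "J_gamma P k =
     (pa P * px P + pc P * pu P) * (of_nat k)\<^sup>2
     + (pa P * py P + pb P * px P + pc P * pv P + 2 * pc P * pu P) * of_nat k
     + pb P * py P + pc P * pv P + pc P * pu P"

definition J_beta :: "('a::comm_semiring_1) params \<Rightarrow> nat \<Rightarrow> 'a" where
  "J_beta P k = pc P * (py P + px P * of_nat k) * of_nat k"

fun J_mat :: "('a::comm_semiring_1) params \<Rightarrow> nat \<Rightarrow> nat \<Rightarrow> 'a" where
  "J_mat P 0 k = (if k = 0 then 1 else 0)"
| "J_mat P (Suc n) k =
     (if k = 0 then 0 else J_delta P (k - 1) * J_mat P n (k - 1))
     + J_gamma P k * J_mat P n k + J_beta P (k + 1) * J_mat P n (k + 1)"

lemma J_mat_eq_0: "n < k \<Longrightarrow> J_mat P n k = 0"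
  by (induction n arbitrary: k) auto

definition J_row :: "('a::comm_semiring_1) params \<Rightarrow> 'a \<Rightarrow> nat \<Rightarrow> 'a" where
  "J_row P q n = (\<Sum>k\<le>n. J_mat P n k * q ^ k)"

text \<open>The reversed polynomial \<open>q\<^sup>n J\<^sub>n(1/q)\<close>, written without division so that \<open>q\<close> may be an
  indeterminate; the lemma below is the equation with division.\<close>

definition J_row_rev :: "('a::comm_semiring_1) params \<Rightarrow> 'a \<Rightarrow> nat \<Rightarrow> 'a" where
  "J_row_rev P q n = (\<Sum>k\<le>n. J_mat P n k * q ^ (n - k))"

lemma J_row_rev_eq:
  fixes q :: "'a::field"
  assumes "q \<noteq> 0"
  shows "J_row_rev P q n = q ^ n * J_row P (1 / q) n"
  unfolding J_row_rev_def J_row_def sum_distrib_left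
  using assms by (intro sum.cong refl) (simp add: power_diff power_one_over field_simps)

definition binomial_mat :: "('a::comm_semiring_1) \<Rightarrow> nat \<Rightarrow> nat \<Rightarrow> 'a" where
  "binomial_mat q n k = of_nat (n choose k) * q ^ (n - k)"

text \<open>Product of infinite matrices whose first factor is lower triangular.\<close>

definition lower_mult ::
  "(nat \<Rightarrow> nat \<Rightarrow> 'a::comm_semiring_1) \<Rightarrow> (nat \<Rightarrow> nat \<Rightarrow> 'a) \<Rightarrow> nat \<Rightarrow> nat \<Rightarrow> 'a" where
  "lower_mult A B n k = (\<Sum>j\<le>n. A n j * B j k)"

datatype var7 = Va | Vb | Vc | Vu | Vv | Vx | Vy

text \<open>\<open>var7\<close> indexes \<open>a, b, c, u, v, x, y\<close>, and \<open>var8\<close> adjoins \<open>q\<close>.\<close>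

datatype var8 = Par var7 | Vq

definition indet_params :: "(var7 \<Rightarrow> 'v) \<Rightarrow> 'v mpol params" where
  "indet_params e =
     \<lparr>pa = indet (e Va), pb = indet (e Vb), pc = indet (e Vc), pu = indet (e Vu),
      pv = indet (e Vv), px = indet (e Vx), py = indet (e Vy)\<rparr>"

abbreviation P7 :: "var7 mpol params" where
  "P7 \<equiv> indet_params (\<lambda>w. w)"

abbreviation P8 :: "var8 mpol params" where
  "P8 \<equiv> indet_params Par"

abbreviation q8 :: "var8 mpol" where
  "q8 \<equiv> indet Vq"

end

theory Submission
  imports
    Defs
    "HOL-Computational_Algebra.Fundamental_Theorem_Algebra"
    "HOL-Probability.Helly_Selection"
begin

text \<open>
  The recurrence says that row \<open>n\<close> of \<open>\<^bold>J\<close> is the first row of \<open>(U L)\<^sup>n\<close> for bidiagonal matrices \<open>U\<close>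
  and \<open>L\<close>. Conjugation by the binomial matrix turns \<open>U\<close> into a tridiagonal and \<open>L\<close> into a bidiagonal
  matrix, both totally positive, so \<open>\<^bold>J \<^bold>B\<^sub>q\<close> is again generated by the powers of a totally positive
  matrix \<open>Q\<close>. By Cauchy--Binet it is totally positive, and so is the Hankel matrix of
  \<open>J\<^sub>n(q) = (Q\<^sup>n)\<^sub>0\<^sub>0\<close>, because \<open>(Q\<^sup>i\<^sup>+\<^sup>j)\<^sub>0\<^sub>0\<close> is the product of a row of \<open>Q\<^sup>i\<close> and a column of \<open>Q\<^sup>j\<close>.
  The first column is the case \<open>q = 0\<close>, the reversed polynomials are the case \<open>q = 1\<close> after rescaling
  \<open>c\<close>, \<open>x\<close>, \<open>y\<close> by \<open>q\<close>, and log-convexity follows by Dodgson condensation.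

  For the convolution, \<open>\<Sum> J\<^sub>n\<^sub>,\<^sub>k x\<^sup>k y\<^sup>n\<^sup>-\<^sup>k\<close> is Hankel-totally positive for all reals \<open>x, y \<ge> 0\<close>, hence its
  Hankel matrix and the shifted one are positive semidefinite, a property that survives integration
  over \<open>x\<close> and \<open>y\<close>. Conversely, a sequence with these two properties is a Stieltjes moment sequence:
  Gauss quadrature represents finitely many terms by a finitely supported measure on \<open>[0, \<infinity>)\<close>, and
  Helly's selection theorem yields a limit.
\<close>

subsection \<open>Minors\<close>

lemma matrix_minor_cong:
  assumes "\<And>i j. i < m \<Longrightarrow> j < m \<Longrightarrow> M (r i) (s j) = M' (r' i) (s' j)"
  shows "matrix_minor M m r s = matrix_minor M' m r' s'"
  unfolding matrix_minor_def
  by (rule arg_cong[of _ _ Determinant.det]) (auto intro!: eq_matI simp: assms)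

lemma matrix_minor_0 [simp]: "matrix_minor M 0 r s = 1"
  by (simp add: matrix_minor_def)

lemma matrix_minor_1 [simp]: "matrix_minor M (Suc 0) r s = M (r 0) (s 0)"
  unfolding matrix_minor_def by (subst det_single) auto

lemma matrix_minor_transpose: "matrix_minor (\<lambda>i j. M j i) m r s = matrix_minor M m s r"
proof -
  let ?A = "Matrix.mat m m (\<lambda>(i, j). M (s i) (r j))"
  have "transpose_mat ?A = Matrix.mat m m (\<lambda>(i, j). M (s j) (r i))"
    by (auto intro!: eq_matI)
  then show ?thesis
    unfolding matrix_minor_def using det_transpose[of ?A m] by simp
qed

lemma matrix_minor_expand_first_row:
  "matrix_minor M (Suc m) r s =
     (\<Sum>j\<le>m. (- 1) ^ j * M (r 0) (s j) * matrix_minor M m (r \<circ> Suc) (s \<circ> insert_index j))"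
proof -
  let ?A = "Matrix.mat (Suc m) (Suc m) (\<lambda>(i, j). M (r i) (s j))"
  have del: "mat_delete ?A 0 j =
      Matrix.mat m m (\<lambda>(i, j'). M ((r \<circ> Suc) i) ((s \<circ> insert_index j) j'))"
    if "j < Suc m" for j
    using that by (auto intro!: eq_matI simp: mat_delete_def insert_index_def)
  have "Determinant.det ?A = (\<Sum>j<Suc m. ?A $$ (0, j) * cofactor ?A 0 j)"
    by (rule laplace_expansion_row) auto
  also have "\<dots> = (\<Sum>j<Suc m. (- 1) ^ j * M (r 0) (s j) *
      matrix_minor M m (r \<circ> Suc) (s \<circ> insert_index j))"
    by (rule sum.cong) (auto simp: cofactor_def del matrix_minor_def mult_ac)
  finally show ?thesis
    by (simp add: matrix_minor_def lessThan_Suc_atMost)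
qed

text \<open>By induction on \<open>p\<close>, expanding along the first row: deleting that row and
  one of the first \<open>p\<close> columns leaves the trailing block untouched, so it factors out
  of the whole expansion.\<close>

lemma matrix_minor_block:
  assumes "p \<le> m" and "\<And>i j. i < p \<Longrightarrow> p \<le> j \<Longrightarrow> j < m \<Longrightarrow> M (r i) (s j) = 0"
  shows "matrix_minor M m r s =
    matrix_minor M p r s * matrix_minor M (m - p) (\<lambda>i. r (i + p)) (\<lambda>i. s (i + p))"
  using assms
proof (induction p arbitrary: m r s)
  case 0
  then show ?case by simp
next
  case (Suc p)
  obtain m' where m: "m = Suc m'" using Suc.prems(1) by (cases m) auto
  let ?T = "\<lambda>m j. (- 1) ^ j * M (r 0) (s j) * matrix_minor M m (r \<circ> Suc) (s \<circ> insert_index j)"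
  have "matrix_minor M m r s = (\<Sum>j\<le>m'. ?T m' j)"
    unfolding m by (rule matrix_minor_expand_first_row)
  also have "\<dots> = (\<Sum>j\<le>p. ?T m' j)"
    using Suc.prems m by (intro sum.mono_neutral_right) auto
  also have "\<dots> = (\<Sum>j\<le>p. ?T p j *
      matrix_minor M (m - Suc p) (\<lambda>i. r (i + Suc p)) (\<lambda>i. s (i + Suc p)))"
  proof (rule sum.cong)
    fix j assume j: "j \<in> {..p}"
    have "matrix_minor M m' (r \<circ> Suc) (s \<circ> insert_index j) =
      matrix_minor M p (r \<circ> Suc) (s \<circ> insert_index j) *
      matrix_minor M (m' - p) (\<lambda>i. (r \<circ> Suc) (i + p)) (\<lambda>i. (s \<circ> insert_index j) (i + p))"
      using Suc.prems j m by (intro Suc.IH) (auto simp: insert_index_def)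
    also have "matrix_minor M (m' - p) (\<lambda>i. (r \<circ> Suc) (i + p)) (\<lambda>i. (s \<circ> insert_index j) (i + p))
      = matrix_minor M (m - Suc p) (\<lambda>i. r (i + Suc p)) (\<lambda>i. s (i + Suc p))"
      using j m by (auto intro!: matrix_minor_cong simp: insert_index_def)
    finally show "?T m' j = ?T p j *
        matrix_minor M (m - Suc p) (\<lambda>i. r (i + Suc p)) (\<lambda>i. s (i + Suc p))"
      by (simp add: mult_ac o_def)
  qed simp
  also have "\<dots> = matrix_minor M (Suc p) r s *
      matrix_minor M (m - Suc p) (\<lambda>i. r (i + Suc p)) (\<lambda>i. s (i + Suc p))"
    by (simp add: matrix_minor_expand_first_row sum_distrib_right)
  finally show ?case .
qed

lemma matrix_minor_block':
  assumes "p \<le> m" and "\<And>i j. i < p \<Longrightarrow> p \<le> j \<Longrightarrow> j < m \<Longrightarrow> M (r j) (s i) = 0"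
  shows "matrix_minor M m r s =
    matrix_minor M p r s * matrix_minor M (m - p) (\<lambda>i. r (i + p)) (\<lambda>i. s (i + p))"
  using matrix_minor_block[of p m "\<lambda>i j. M j i" s r] assms
  by (simp only: matrix_minor_transpose[of M])

subsection \<open>The Cauchy--Binet formula\<close>

text \<open>The shape is that of the index set in \<open>det_linear_rows_sum\<close>. Fixing the
  values outside \<open>{0..<m}\<close> makes the set finite and closed under composition with
  permutations of \<open>{0..<m}\<close>.\<close>

definition index_maps :: "nat \<Rightarrow> nat \<Rightarrow> (nat \<Rightarrow> nat) set" where
  "index_maps m K = {f. (\<forall>i\<in>{0..<m}. f i \<in> {..<K}) \<and> (\<forall>i. i \<notin> {0..<m} \<longrightarrow> f i = i)}"

text \<open>Each row of the product is a linear combination of rows of \<open>B\<close>;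
  multilinearity of the determinant in its rows gives one term per choice \<open>f\<close> of
  rows.\<close>

lemma matrix_minor_mult_index_maps:
  "matrix_minor (\<lambda>i j. \<Sum>k<K. A i k * B k j) m r s =
     (\<Sum>f\<in>index_maps m K. (\<Prod>i<m. A (r i) (f i)) * matrix_minor B m f s)"
proof -
  let ?b = "\<lambda>k. Matrix.vec m (\<lambda>j. B k (s j))"
  let ?a = "\<lambda>i k. A (r i) k \<cdot>\<^sub>v ?b k"
  have "Matrix.mat m m (\<lambda>(i, j). \<Sum>k<K. A (r i) k * B k (s j)) =
    mat\<^sub>r m m (\<lambda>i. finsum_vec TYPE('a) m (?a i) {..<K})"
    by (rule eq_matI) (auto simp: index_finsum_vec)
  then have "matrix_minor (\<lambda>i j. \<Sum>k<K. A i k * B k j) m r s =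
    Determinant.det (mat\<^sub>r m m (\<lambda>i. finsum_vec TYPE('a) m (?a i) {..<K}))"
    by (simp add: matrix_minor_def)
  also have "\<dots> = (\<Sum>f\<in>index_maps m K. Determinant.det (mat\<^sub>r m m (\<lambda>i. ?a i (f i))))"
    unfolding index_maps_def by (rule det_linear_rows_sum) auto
  also have "\<dots> = (\<Sum>f\<in>index_maps m K. (\<Prod>i<m. A (r i) (f i)) * matrix_minor B m f s)"
  proof (rule sum.cong)
    fix f assume "f \<in> index_maps m K"
    have "Determinant.det (mat\<^sub>r m m (\<lambda>i. ?a i (f i))) =
      prod (\<lambda>i. A (r i) (f i)) {0..<m} * Determinant.det (mat\<^sub>r m m (\<lambda>i. ?b (f i)))"
      by (rule det_rows_mul) auto
    also have "mat\<^sub>r m m (\<lambda>i. ?b (f i)) = Matrix.mat m m (\<lambda>(i, j). B (f i) (s j))"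
      by (rule eq_matI) auto
    finally show "Determinant.det (mat\<^sub>r m m (\<lambda>i. ?a i (f i))) =
        (\<Prod>i<m. A (r i) (f i)) * matrix_minor B m f s"
      by (simp add: matrix_minor_def lessThan_atLeast0)
  qed simp
  finally show ?thesis .
qed

lemma matrix_minor_eq_0_if_not_inj:
  assumes "\<not> inj_on f {0..<m}"
  shows "matrix_minor B m f s = 0"
proof -
  obtain i j where ij: "i < m" "j < m" "i \<noteq> j" "f i = f j"
    using assms by (auto simp: inj_on_def)
  show ?thesis
    unfolding matrix_minor_def
    by (rule det_identical_rows[of _ m i j]) (use ij in auto)
qed

lemma matrix_minor_permute_rows:
  assumes "p permutes {0..<m}"
  shows "matrix_minor B m (f \<circ> p) s = signof p * matrix_minor B m f s"
proof -
  let ?A = "Matrix.mat m m (\<lambda>(i, j). B (f i) (s j))"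
  have "Matrix.mat m m (\<lambda>(i, j). ?A $$ (p i, j)) = Matrix.mat m m (\<lambda>(i, j). B ((f \<circ> p) i) (s j))"
    using permutes_in_image[OF assms] by (intro eq_matI) auto
  then show ?thesis
    using det_permute_rows[of ?A m p] assms by (simp add: matrix_minor_def)
qed

lemma matrix_minor_leibniz:
  "matrix_minor A m r s =
    (\<Sum>p | p permutes {0..<m}. signof p * (\<Prod>i<m. A (r i) (s (p i))))"
  unfolding matrix_minor_def
  by (subst det_def'[of _ m])
     (auto intro!: sum.cong prod.cong arg_cong2[of _ _ _ _ "(*)"]
           simp: lessThan_atLeast0 dest: permutes_in_image)

lemma strict_mono_on_image_eqD:
  fixes g h :: "nat \<Rightarrow> nat"
  assumes g: "strict_mono_on {..<m} g" and h: "strict_mono_on {..<m} h"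
    and im: "g ` {..<m} = h ` {..<m}" and "i < m"
  shows "g i = h i"
proof -
  have srt: "sorted (map f [0..<m]) \<and> distinct (map f [0..<m])"
    if f: "strict_mono_on {..<m} f" for f :: "nat \<Rightarrow> nat"
  proof
    show "distinct (map f [0..<m])"
      using strict_mono_on_imp_inj_on[OF f] by (auto simp: distinct_map lessThan_atLeast0)
    show "sorted (map f [0..<m])"
      using strict_mono_onD[OF f]
      by (auto simp: sorted_iff_nth_mono_less intro!: less_imp_le)
  qed
  have "map g [0..<m] = map h [0..<m]"
    using srt[OF g] srt[OF h] im
    by (intro sorted_distinct_set_unique) (auto simp: lessThan_atLeast0)
  then show ?thesis using \<open>i < m\<close> by (auto simp: map_eq_conv)
qed

text \<open>Sorting: \<open>g\<close> lists the image of \<open>f\<close> in increasing order and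
  \<open>p i\<close> is the position of \<open>f i\<close> in that list.\<close>

lemma inj_index_map_factor:
  assumes f: "f \<in> index_maps m K" and inj: "inj_on f {0..<m}"
  obtains g p where "g \<in> index_maps m K" "strict_mono_on {..<m} g" "p permutes {0..<m}" "f = g \<circ> p"
proof -
  let ?xs = "sorted_list_of_set (f ` {0..<m})"
  define g where "g i = (if i < m then ?xs ! i else i)" for i
  define p where "p i = (if i < m then inv_into {0..<m} g (f i) else i)" for i
  have len: "length ?xs = m" using card_image[OF inj] by simp
  have st: "set ?xs = f ` {0..<m}" by simp
  have sm: "strict_mono_on {..<m} g"
    using strict_sorted_list_of_set[of "f ` {0..<m}"] len
    by (auto simp: g_def strict_mono_on_def sorted_wrt_iff_nth_less)
  have im: "g ` {0..<m} = f ` {0..<m}"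
  proof -
    have "g ` {0..<m} = (!) ?xs ` {0..<m}" by (auto simp: g_def)
    also have "\<dots> = set ?xs" using len by (auto simp: set_conv_nth image_iff)
    finally show ?thesis using st by simp
  qed
  have ginj: "inj_on g {0..<m}"
    using strict_mono_on_imp_inj_on[OF sm] by (simp add: lessThan_atLeast0)
  have gp: "g (p i) = f i" if "i < m" for i
    using that im by (auto simp: p_def intro!: f_inv_into_f)
  have pin: "p i < m" if "i < m" for i
    using that im inv_into_into[of "f i" g "{0..<m}"] by (auto simp: p_def)
  have pinj: "inj_on p {0..<m}"
  proof (rule inj_onI)
    fix i j assume "i \<in> {0..<m}" "j \<in> {0..<m}" "p i = p j"
    then show "i = j" using gp[of i] gp[of j] inj by (auto simp: inj_on_def)
  qed
  have "bij_betw p {0..<m} {0..<m}"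
    unfolding bij_betw_def using pinj pin by (intro conjI endo_inj_surj) auto
  then have perm: "p permutes {0..<m}"
    by (rule bij_imp_permutes) (simp add: p_def)
  have fg: "f = g \<circ> p"
  proof
    fix i show "f i = (g \<circ> p) i"
      using gp[of i] f by (cases "i < m") (auto simp: index_maps_def p_def g_def)
  qed
  have "g i < K" if "i < m" for i
  proof -
    have "g i \<in> f ` {0..<m}" using im that by auto
    then show ?thesis using f by (auto simp: index_maps_def)
  qed
  then have "g \<in> index_maps m K" by (auto simp: index_maps_def g_def)
  then show ?thesis using that sm perm fg by blast
qed

lemma finite_index_maps: "finite (index_maps m K)"
proof -
  have "index_maps m K \<subseteq> {f. (\<forall>i\<in>{0..<m}. f i \<in> {..<K}) \<and> (\<forall>i. i \<notin> {0..<m} \<longrightarrow> f i = i)}"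
    by (simp add: index_maps_def)
  moreover have "finite {f. (\<forall>i\<in>{0..<m}. f i \<in> {..<K}) \<and> (\<forall>i. i \<notin> {0..<m} \<longrightarrow> f i = i)}"
    by (rule finite_bounded_functions) auto
  ultimately show ?thesis by (rule finite_subset)
qed

text \<open>Choices of rows with a repetition contribute nothing. The injective ones factor uniquely
  as \<open>g \<circ> p\<close>, and for fixed \<open>g\<close> the signed sum over \<open>p\<close>
  is the Leibniz formula for the minor of \<open>A\<close>.\<close>

theorem Cauchy_Binet:
  "matrix_minor (\<lambda>i j. \<Sum>k<K. A i k * B k j) m r s =
     (\<Sum>g | g \<in> index_maps m K \<and> strict_mono_on {..<m} g.
        matrix_minor A m r g * matrix_minor B m g s)"
proof -
  let ?G = "{g \<in> index_maps m K. strict_mono_on {..<m} g}"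
  let ?P = "{p. p permutes {0..<m}}"
  let ?I = "{f \<in> index_maps m K. inj_on f {0..<m}}"
  let ?t = "\<lambda>f. (\<Prod>i<m. A (r i) (f i)) * matrix_minor B m f s"
  have "bij_betw (\<lambda>(g, p). g \<circ> p) (?G \<times> ?P) ?I"
  proof (rule bij_betwI')
    fix a b assume a: "a \<in> ?G \<times> ?P" and b: "b \<in> ?G \<times> ?P"
    obtain g p h q where ab: "a = (g, p)" "b = (h, q)" by (cases a, cases b) auto
    have g: "g \<in> index_maps m K" "strict_mono_on {..<m} g" "p permutes {0..<m}"
      and h: "h \<in> index_maps m K" "strict_mono_on {..<m} h" "q permutes {0..<m}"
      using a b ab by auto
    show "((\<lambda>(g, p). g \<circ> p) a = (\<lambda>(g, p). g \<circ> p) b) = (a = b)"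
    proof
      assume "(\<lambda>(g, p). g \<circ> p) a = (\<lambda>(g, p). g \<circ> p) b"
      then have eq: "g \<circ> p = h \<circ> q" by (simp add: ab)
      have "g ` {..<m} = (g \<circ> p) ` {..<m}"
        using permutes_image[OF g(3)] by (metis image_comp lessThan_atLeast0)
      also have "\<dots> = h ` {..<m}"
        using permutes_image[OF h(3)] eq by (metis image_comp lessThan_atLeast0)
      finally have im: "g ` {..<m} = h ` {..<m}" .
      have gh: "g = h"
      proof
        fix i show "g i = h i"
          using strict_mono_on_image_eqD[OF g(2) h(2) im, of i] g(1) h(1)
          by (cases "i < m") (auto simp: index_maps_def)
      qed
      have "p i = q i" for i
      proof (cases "i < m")
        case True
        have "g (p i) = g (q i)" using eq gh by (metis comp_apply)
        moreover have "p i < m" "q i < m"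
          using True permutes_in_image[OF g(3), of i] permutes_in_image[OF h(3), of i] by auto
        ultimately show ?thesis
          using strict_mono_on_imp_inj_on[OF g(2)] by (auto simp: inj_on_def)
      next
        case False
        then show ?thesis
          using permutes_not_in[OF g(3), of i] permutes_not_in[OF h(3), of i] by simp
      qed
      then show "a = b" using gh ab by auto
    qed simp
  next
    fix a assume a: "a \<in> ?G \<times> ?P"
    obtain g p where ag: "a = (g, p)" by (cases a) auto
    have g: "g \<in> index_maps m K" "strict_mono_on {..<m} g" "p permutes {0..<m}"
      using a ag by auto
    have pin: "p i < m \<longleftrightarrow> i < m" for i
      using permutes_in_image[OF g(3), of i] by auto
    have "inj_on (g \<circ> p) {0..<m}"
      using strict_mono_on_imp_inj_on[OF g(2)] permutes_image[OF g(3)] permutes_inj_on[OF g(3)]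
      by (intro comp_inj_on) (auto simp: lessThan_atLeast0)
    moreover have "g \<circ> p \<in> index_maps m K"
      using g(1) pin permutes_not_in[OF g(3)] by (auto simp: index_maps_def)
    ultimately show "(\<lambda>(g, p). g \<circ> p) a \<in> ?I" by (simp add: ag)
  next
    fix f assume f: "f \<in> ?I"
    obtain g p where "g \<in> index_maps m K" "strict_mono_on {..<m} g" "p permutes {0..<m}"
      "f = g \<circ> p" using f by (blast intro: inj_index_map_factor[of f m K])
    then show "\<exists>a\<in>?G \<times> ?P. f = (\<lambda>(g, p). g \<circ> p) a"
      by (intro bexI[of _ "(g, p)"]) auto
  qed
  note bij = this
  have "matrix_minor (\<lambda>i j. \<Sum>k<K. A i k * B k j) m r s = sum ?t (index_maps m K)"
    by (rule matrix_minor_mult_index_maps)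
  also have "\<dots> = sum ?t ?I"
    by (rule sum.mono_neutral_right) (auto simp: finite_index_maps matrix_minor_eq_0_if_not_inj)
  also have "\<dots> = (\<Sum>(g, p)\<in>?G \<times> ?P. ?t (g \<circ> p))"
    using sum.reindex_bij_betw[OF bij, of ?t] by (simp add: case_prod_beta)
  also have "\<dots> = (\<Sum>g\<in>?G. \<Sum>p\<in>?P. ?t (g \<circ> p))"
    by (rule sum.cartesian_product[symmetric])
  also have "\<dots> = (\<Sum>g\<in>?G. matrix_minor A m r g * matrix_minor B m g s)"
    by (rule sum.cong)
       (auto simp: matrix_minor_permute_rows matrix_minor_leibniz[of A m r] sum_distrib_right sum_distrib_left mult_ac
             intro!: sum.cong)
  finally show ?thesis by simp
qed

lemma bounded_initial_values: "\<exists>n. \<forall>i<m. r i < n" for r :: "nat \<Rightarrow> nat"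
  by (intro exI[of _ "Suc (\<Sum>i<m. r i)"]) (auto intro!: member_le_sum le_imp_less_Suc)

subsection \<open>Total positivity over a ring with a positive cone\<close>

text \<open>The abstract cone has two instances, polynomials with nonnegative coefficients for the
  coefficientwise claims and nonnegative reals for the moment claim. Positivity arguments over it
  have to be free of subtraction.\<close>

locale positivity =
  fixes pos :: "'a::comm_ring_1 \<Rightarrow> bool"
  assumes pos_0 [simp, intro]: "pos 0" and pos_1 [simp, intro]: "pos 1"
    and pos_add [intro]: "pos a \<Longrightarrow> pos b \<Longrightarrow> pos (a + b)"
    and pos_mult [intro]: "pos a \<Longrightarrow> pos b \<Longrightarrow> pos (a * b)"
begin

lemma pos_sum: "(\<And>i. i \<in> A \<Longrightarrow> pos (f i)) \<Longrightarrow> pos (sum f A)"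
  by (induction A rule: infinite_finite_induct) auto

lemma pos_of_nat [simp, intro]: "pos (of_nat n)"
  by (induction n) auto

lemma pos_power [intro]: "pos a \<Longrightarrow> pos (a ^ n)"
  by (induction n) auto

definition tp :: "(nat \<Rightarrow> nat \<Rightarrow> 'a) \<Rightarrow> bool" where
  "tp M \<longleftrightarrow> (\<forall>m r s. strict_mono_on {..<m} r \<longrightarrow> strict_mono_on {..<m} s \<longrightarrow>
     pos (matrix_minor M m r s))"

lemma tpD: "tp M \<Longrightarrow> strict_mono_on {..<m} r \<Longrightarrow> strict_mono_on {..<m} s \<Longrightarrow>
    pos (matrix_minor M m r s)"
  by (auto simp: tp_def)

lemma tp_transpose: "tp M \<Longrightarrow> tp (\<lambda>i j. M j i)"
  unfolding tp_def matrix_minor_transpose[of M] by blast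

text \<open>The hypothesis on \<open>A\<close> concerns the rows \<open>r\<close> alone, and
  \<open>C\<close> may have other rows \<open>r'\<close>: in \<open>tp_output\<close> only some
  minors of \<open>A\<close> are known to be positive, by induction, and \<open>r\<close> is
  \<open>r'\<close> lowered by one.\<close>

lemma pos_minor_mult:
  assumes "\<And>g. strict_mono_on {..<m} g \<Longrightarrow> pos (matrix_minor A m r g)"
    and "\<And>g. strict_mono_on {..<m} g \<Longrightarrow> pos (matrix_minor B m g s)"
    and "\<And>i j. i < m \<Longrightarrow> j < m \<Longrightarrow> C (r' i) (s j) = (\<Sum>k<K. A (r i) k * B k (s j))"
  shows "pos (matrix_minor C m r' s)"
proof -
  have "matrix_minor C m r' s = matrix_minor (\<lambda>i j. \<Sum>k<K. A i k * B k j) m r s"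
    by (rule matrix_minor_cong) (simp add: assms(3))
  then show ?thesis
    unfolding Cauchy_Binet using assms(1,2) by (auto intro!: pos_sum)
qed

text \<open>A minor meets finitely many rows, so it is enough that the infinite product can be
  truncated at a \<open>K\<close> depending on a bound for the rows.\<close>

lemma tp_mult:
  assumes "tp A" "tp B"
    and "\<And>n. \<exists>K. \<forall>i<n. \<forall>j. C i j = (\<Sum>k<K. A i k * B k j)"
  shows "tp C"
  unfolding tp_def
proof (intro allI impI)
  fix m and r s :: "nat \<Rightarrow> nat" assume r: "strict_mono_on {..<m} r" and s: "strict_mono_on {..<m} s"
  obtain n where n: "\<And>i. i < m \<Longrightarrow> r i < n"
    using bounded_initial_values[of m r] by blast
  obtain K where K: "\<forall>i<n. \<forall>j. C i j = (\<Sum>k<K. A i k * B k j)"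
    using assms(3) by blast
  show "pos (matrix_minor C m r s)"
  proof (rule pos_minor_mult[where A = A and B = B and r = r and K = K])
    fix g :: "nat \<Rightarrow> nat" assume g: "strict_mono_on {..<m} g"
    show "pos (matrix_minor A m r g)" by (rule tpD[OF assms(1) r g])
    show "pos (matrix_minor B m g s)" by (rule tpD[OF assms(2) g s])
  qed (use K n in simp)
qed

text \<open>Where \<open>r\<close> and \<open>s\<close> disagree or have a gap, a minor of a tridiagonal matrix splits into
  smaller ones, so only the contiguous principal minors \<open>D i k\<close> matter; for these the three-term
  recurrence propagates positivity of \<open>D i (k + 1) - e i * D (i + 1) k\<close>.\<close>

lemma tp_tridiagonal:
  assumes up: "\<And>i j. Suc i < j \<Longrightarrow> M i j = 0" and low: "\<And>i j. Suc j < i \<Longrightarrow> M i j = 0"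
    and pos: "\<And>i. pos (M i (Suc i))" "\<And>i. pos (M (Suc i) i)"
      "\<And>i. pos (e i)" "\<And>i. pos (h i)" "\<And>i. pos (w i)"
    and diag: "\<And>i. M i i = e i + h i + w i"
    and off: "\<And>i. M i (Suc i) * M (Suc i) i = h i * e (Suc i)"
  shows "tp M"
proof -
  define D where "D i k = matrix_minor M k (\<lambda>j. i + j) (\<lambda>j. i + j)" for i k
  have D0: "D i 0 = 1" and D1: "D i (Suc 0) = M i i" for i
    by (simp_all add: D_def)
  \<comment> \<open>The continuant recurrence: the first row has two nonzero entries, and once
    column 1 is deleted the first column of the remaining minor has the single nonzero entry
    \<open>M (Suc i) i\<close>.\<close>
  have rec: "D i (Suc (Suc k)) = M i i * D (Suc i) (Suc k) - h i * e (Suc i) * D (Suc (Suc i)) k"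
    for i k
  proof -
    let ?r = "\<lambda>j. i + j"
    let ?T = "\<lambda>j. (- 1) ^ j * M (?r 0) (?r j) *
      matrix_minor M (Suc k) (?r \<circ> Suc) (?r \<circ> insert_index j)"
    have "D i (Suc (Suc k)) = (\<Sum>j\<le>Suc k. ?T j)"
      unfolding D_def by (rule matrix_minor_expand_first_row)
    also have "\<dots> = (\<Sum>j\<in>{0, 1}. ?T j)"
      by (rule sum.mono_neutral_right) (auto simp: up)
    also have "\<dots> = ?T 0 + ?T 1" by simp
    also have "?T 0 = M i i * D (Suc i) (Suc k)"
      unfolding D_def by (auto intro!: arg_cong2[of _ _ _ _ "(*)"] matrix_minor_cong
        simp: insert_index_def)
    also have "matrix_minor M (Suc k) (?r \<circ> Suc) (?r \<circ> insert_index 1) =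
        matrix_minor M 1 (?r \<circ> Suc) (?r \<circ> insert_index 1) *
        matrix_minor M (Suc k - 1) (\<lambda>j. (?r \<circ> Suc) (j + 1)) (\<lambda>j. (?r \<circ> insert_index 1) (j + 1))"
      by (rule matrix_minor_block') (auto simp: insert_index_def low)
    also have "\<dots> = M (Suc i) i * D (Suc (Suc i)) k"
      unfolding D_def by (auto intro!: arg_cong2[of _ _ _ _ "(*)"] matrix_minor_cong
        simp: insert_index_def)
    finally show ?thesis
      unfolding off[of i, symmetric] by (simp add: mult_ac)
  qed
  have "pos (D i k) \<and> pos (D i (Suc k) - e i * D (Suc i) k)" for i k
  proof (induction k arbitrary: i)
    case 0
    then show ?case using pos by (auto simp: D0 D1 diag add.assoc)
  next
    case (Suc k)
    \<comment> \<open>Of the three parts of \<open>M i i\<close>, \<open>e i\<close> cancels and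
      \<open>h i\<close> absorbs the negative term of \<open>rec\<close>; what remains is positive
      by induction.\<close>
    have eq: "D i (Suc (Suc k)) - e i * D (Suc i) (Suc k) =
      w i * D (Suc i) (Suc k) + h i * (D (Suc i) (Suc k) - e (Suc i) * D (Suc (Suc i)) k)" for i
      by (simp add: rec diag algebra_simps)
    have "D i (Suc k) = (D i (Suc k) - e i * D (Suc i) k) + e i * D (Suc i) k" for i by simp
    then have pD: "pos (D i (Suc k))" for i
      using Suc.IH pos by (metis pos_add pos_mult)
    show ?case
      unfolding eq using pD Suc.IH pos by (auto intro!: pos_add pos_mult)
  qed
  then have posD: "pos (D i k)" for i k by simp
  have "pos (matrix_minor M m r s)"
    if "strict_mono_on {..<m} r" "strict_mono_on {..<m} s" for m and r s :: "nat \<Rightarrow> nat"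
    using that
  proof (induction m arbitrary: r s rule: less_induct)
    case (less m)
    note r = strict_mono_onD[OF less.prems(1)] and s = strict_mono_onD[OF less.prems(2)]
    have rec: "pos (matrix_minor M p r s)"
      "q + p \<le> m \<Longrightarrow> pos (matrix_minor M q (\<lambda>i. r (i + p)) (\<lambda>i. s (i + p)))"
      if "p < m" "q < m" for p q
      using that r s by (auto intro!: less.IH strict_mono_onI)
    have gap: "r i + (j - i) \<le> r j" "s i + (j - i) \<le> s j" if "i \<le> j" "j < m" for i j
      using that
    proof (induction j)
      case (Suc j)
      { case 1 then show ?case using Suc r[of j "Suc j"] by (cases "i = Suc j") (auto simp: Suc_diff_le) }
      { case 2 then show ?case using Suc s[of j "Suc j"] by (cases "i = Suc j") (auto simp: Suc_diff_le) }
    qed auto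
    consider (less) i where "i < m" "r i < s i" | (gt) i where "i < m" "s i < r i"
      | (gap) i where "\<And>i. i < m \<Longrightarrow> r i = s i" "Suc i < m" "Suc (r i) < r (Suc i)"
      | (contig) "\<And>i. i < m \<Longrightarrow> r i = s i" "\<And>i. Suc i < m \<Longrightarrow> r (Suc i) = Suc (r i)"
    proof -
      have "r (Suc i) = Suc (r i)" if "Suc i < m" "\<not> Suc (r i) < r (Suc i)" for i
        using that r[of i "Suc i"] by auto
      then show thesis using less gt gap contig by (meson linorder_neqE_nat)
    qed
    then show ?case
    proof cases
      case (less i)
      \<comment> \<open>Index sequences grow by at least one per step, so \<open>r i < s i\<close>
        pushes every other entry above and to the right of position \<open>(i, i)\<close> off the
        band. The minor then splits into three factors around that entry.\<close>
      have far: "M (r k) (s l) = 0" if "k \<le> i" "i \<le> l" "l < m" "(k, l) \<noteq> (i, i)" for k l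
        using gap[of k i] gap[of i l] less that by (intro up) auto
      have "matrix_minor M m r s = matrix_minor M i r s *
          matrix_minor M (m - i) (\<lambda>j. r (j + i)) (\<lambda>j. s (j + i))"
        using less by (intro matrix_minor_block far) auto
      also have "matrix_minor M (m - i) (\<lambda>j. r (j + i)) (\<lambda>j. s (j + i)) =
        matrix_minor M 1 (\<lambda>j. r (j + i)) (\<lambda>j. s (j + i)) *
        matrix_minor M (m - i - 1) (\<lambda>j. r (j + 1 + i)) (\<lambda>j. s (j + 1 + i))"
        using less by (intro matrix_minor_block far) auto
      finally have eq: "matrix_minor M m r s = matrix_minor M i r s * (M (r i) (s i) *
          matrix_minor M (m - i - 1) (\<lambda>j. r (j + 1 + i)) (\<lambda>j. s (j + 1 + i)))"
        by simp
      have "pos (M (r i) (s i))"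
        using pos(1)[of "r i"] up[of "r i" "s i"] less by (cases "s i = Suc (r i)") auto
      moreover have "pos (matrix_minor M (m - i - 1) (\<lambda>j. r (j + 1 + i)) (\<lambda>j. s (j + 1 + i)))"
        using less r s by (intro less.IH strict_mono_onI) auto
      ultimately show ?thesis using rec(1)[of i 0] less unfolding eq by (intro pos_mult) auto
    next
      case (gt i)
      have far: "M (r l) (s k) = 0" if "k \<le> i" "i \<le> l" "l < m" "(k, l) \<noteq> (i, i)" for k l
        using gap[of k i] gap[of i l] gt that by (intro low) auto
      have "matrix_minor M m r s = matrix_minor M i r s *
          matrix_minor M (m - i) (\<lambda>j. r (j + i)) (\<lambda>j. s (j + i))"
        using gt by (intro matrix_minor_block' far) auto
      also have "matrix_minor M (m - i) (\<lambda>j. r (j + i)) (\<lambda>j. s (j + i)) =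
        matrix_minor M 1 (\<lambda>j. r (j + i)) (\<lambda>j. s (j + i)) *
        matrix_minor M (m - i - 1) (\<lambda>j. r (j + 1 + i)) (\<lambda>j. s (j + 1 + i))"
        using gt by (intro matrix_minor_block' far) auto
      finally have eq: "matrix_minor M m r s = matrix_minor M i r s * (M (r i) (s i) *
          matrix_minor M (m - i - 1) (\<lambda>j. r (j + 1 + i)) (\<lambda>j. s (j + 1 + i)))"
        by simp
      have "pos (M (r i) (s i))"
        using pos(2)[of "s i"] low[of "s i" "r i"] gt by (cases "r i = Suc (s i)") auto
      moreover have "pos (matrix_minor M (m - i - 1) (\<lambda>j. r (j + 1 + i)) (\<lambda>j. s (j + 1 + i)))"
        using gt r s by (intro less.IH strict_mono_onI) auto
      ultimately show ?thesis using rec(1)[of i 0] gt unfolding eq by (intro pos_mult) auto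
    next
      case (gap i)
      have "matrix_minor M m r s = matrix_minor M (Suc i) r s *
          matrix_minor M (m - Suc i) (\<lambda>j. r (j + Suc i)) (\<lambda>j. s (j + Suc i))"
      proof (rule matrix_minor_block)
        fix k l assume "k < Suc i" "Suc i \<le> l" "l < m"
        then have "r k \<le> r i" "r (Suc i) \<le> r l" "s l = r l"
          using \<open>\<And>i j. i \<le> j \<Longrightarrow> j < m \<Longrightarrow> r i + (j - i) \<le> r j\<close>[of k i] gap
            \<open>\<And>i j. i \<le> j \<Longrightarrow> j < m \<Longrightarrow> r i + (j - i) \<le> r j\<close>[of "Suc i" l] by auto
        then show "M (r k) (s l) = 0" using gap by (intro up) auto
      qed (use gap in auto)
      then show ?thesis using rec(1)[of "Suc i" 0] rec(2)[of "Suc i" "m - Suc i"] gap by auto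
    next
      case contig
      have ri: "r i = r 0 + i" if "i < m" for i
        using that by (induction i) (simp_all add: contig(2))
      have "M (r i) (s j) = M (r 0 + i) (r 0 + j)" if "i < m" "j < m" for i j
        by (simp only: contig(1)[OF that(2), symmetric] ri[OF that(1)] ri[OF that(2)])
      then have "matrix_minor M m r s = D (r 0) m"
        unfolding D_def by (rule matrix_minor_cong)
      then show ?thesis by (simp add: posD)
    qed
  qed
  then show ?thesis by (simp add: tp_def)
qed

text \<open>\<open>T\<close> is the matrix whose \<open>n\<close>-th row is the first row of \<open>Q\<^sup>n\<close>.\<close>

lemma tp_output:
  assumes Q: "tp Q" and T0: "\<And>k. T 0 k = (if k = 0 then 1 else 0)"
    and TSuc: "\<And>n. \<exists>K. \<forall>i<n. \<forall>j. T (Suc i) j = (\<Sum>k<K. T i k * Q k j)"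
  shows "tp T"
proof -
  have "pos (matrix_minor T m r s)"
    if "strict_mono_on {..<m} r" "strict_mono_on {..<m} s" for m and r s :: "nat \<Rightarrow> nat"
    using that
  \<comment> \<open>If row 0 occurs, it is a unit vector and splits off, which lowers
    \<open>m\<close>. Otherwise all rows are lowered by one at the price of a factor
    \<open>Q\<close>, which lowers the sum of the row indices.\<close>
  proof (induction "(\<Sum>i<m. r i) + m" arbitrary: m r s rule: less_induct)
    case less
    note r = strict_mono_onD[OF less.prems(1)] and s = strict_mono_onD[OF less.prems(2)]
    show ?case
    proof (cases m)
      case 0
      then show ?thesis by simp
    next
      case (Suc m')
      show ?thesis
      proof (cases "r 0 = 0")
        case True
        have nz: "s j \<noteq> 0" if "1 \<le> j" "j < m" for j
          using s[of 0 j] that by auto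
        have "matrix_minor T m r s = matrix_minor T 1 r s *
            matrix_minor T (m - 1) (\<lambda>i. r (i + 1)) (\<lambda>i. s (i + 1))"
          using Suc True nz by (intro matrix_minor_block) (auto simp: T0)
        moreover have "pos (matrix_minor T (m - 1) (\<lambda>i. r (i + 1)) (\<lambda>i. s (i + 1)))"
        proof (rule less.hyps)
          have "(\<Sum>i<m. r i) = r 0 + (\<Sum>i<m'. r (Suc i))"
            unfolding Suc by (rule sum.lessThan_Suc_shift)
          then show "(\<Sum>i<m - 1. r (i + 1)) + (m - 1) < (\<Sum>i<m. r i) + m"
            using Suc by simp
        qed (use r s Suc in \<open>auto intro!: strict_mono_onI\<close>)
        ultimately show ?thesis using True by (auto simp: T0)
      next
        case False
        have r1: "0 < r i" if "i < m" for i
          using r[of 0 i] False that by (cases i) auto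
        obtain n where n: "\<And>i. i < m \<Longrightarrow> r i < n"
          using bounded_initial_values[of m r] by blast
        obtain K where K: "\<forall>i<n. \<forall>j. T (Suc i) j = (\<Sum>k<K. T i k * Q k j)"
          using TSuc by blast
        show ?thesis
        proof (rule pos_minor_mult[where A = T and B = Q and r = "\<lambda>i. r i - 1" and K = K])
          fix g :: "nat \<Rightarrow> nat" assume g: "strict_mono_on {..<m} g"
          show "pos (matrix_minor Q m g s)" by (rule tpD[OF Q g less.prems(2)])
          show "pos (matrix_minor T m (\<lambda>i. r i - 1) g)"
          proof (rule less.hyps[OF _ _ g])
            have "(\<Sum>i<m. r i - 1) < (\<Sum>i<m. r i)"
              using r1 Suc by (intro sum_strict_mono) auto
            then show "(\<Sum>i<m. r i - 1) + m < (\<Sum>i<m. r i) + m" by simp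
            show "strict_mono_on {..<m} (\<lambda>i. r i - 1)"
              using r r1 by (auto intro!: strict_mono_onI diff_less_mono Suc_leI)
          qed
        next
          fix i j assume "i < m" "j < m"
          then show "T (r i) (s j) = (\<Sum>k<K. T (r i - 1) k * Q k (s j))"
            using K[rule_format, of "r i - 1" "s j"] r1[of i] n[of i] by simp
        qed
      qed
    qed
  qed
  then show ?thesis by (simp add: tp_def)
qed

end

subsection \<open>Production matrices\<close>

lemma sum_lessThan_cong_support:
  fixes f :: "nat \<Rightarrow> 'b::comm_monoid_add"
  assumes "\<And>i. N \<le> i \<Longrightarrow> f i = 0" "N \<le> K"
  shows "(\<Sum>i<K. f i) = (\<Sum>i<N. f i)"
  using assms by (intro sum.mono_neutral_right) auto

context positivity
begin

text \<open>The band conditions keep the products finite: by \<open>up\<close>, row \<open>n\<close>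
  of \<open>T\<close> ends at column \<open>n\<close>; by \<open>low\<close>, column 0 of
  \<open>Q^j\<close> ends at row \<open>j * b\<close>. Both families are outputs in the sense of
  \<open>tp_output\<close>, of \<open>Q\<close> and of its transpose.\<close>

lemma hankel_tp_production:
  assumes Q: "tp Q" and up: "\<And>i j. Suc i < j \<Longrightarrow> Q i j = 0" and low: "\<And>i j. j + b < i \<Longrightarrow> Q i j = 0"
    and T0: "\<And>k. T 0 k = (if k = 0 then 1 else 0)"
    and TSuc: "\<And>n k. T (Suc n) k = (\<Sum>i<Suc n. T n i * Q i k)"
  shows "tp T" and "tp (\<lambda>i j. T (i + j) 0)"
proof -
  have T_eq_0: "T n k = 0" if "n < k" for n k
    using that by (cases n) (auto simp: T0 TSuc up)
  have T_sum: "(\<Sum>k<K. T n k * f k) = (\<Sum>k<Suc n. T n k * f k)" if "Suc n \<le> K" for n K and f :: "nat \<Rightarrow> 'a"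
    using that by (intro sum_lessThan_cong_support) (auto simp: T_eq_0)
  show T: "tp T"
  proof (rule tp_output[of Q T])
    fix n
    have "T (Suc i) j = (\<Sum>k<n. T i k * Q k j)" if "i < n" for i j
      by (simp only: T_sum[OF Suc_leI[OF that]] TSuc)
    then show "\<exists>K. \<forall>i<n. \<forall>j. T (Suc i) j = (\<Sum>k<K. T i k * Q k j)" by blast
  qed (fact Q T0)+
  \<comment> \<open>\<open>C j k\<close> is the entry of \<open>Q^j\<close> in row \<open>k\<close>
    and column 0; row \<open>k\<close> of \<open>Q\<close> ends at column \<open>k + 1\<close>,
    hence the range of summation.\<close>
  define C where "C = rec_nat (\<lambda>k. if k = 0 then 1 else 0) (\<lambda>_ c k. \<Sum>i<k + 2. Q k i * c i)"
  have C0: "C 0 k = (if k = 0 then 1 else 0)" and CSuc: "C (Suc j) k = (\<Sum>i<k + 2. Q k i * C j i)"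
    for j k by (simp_all add: C_def)
  have C_eq_0: "C j k = 0" if "j * b < k" for j k
    using that
  proof (induction j arbitrary: k)
    case (Suc j)
    have "Q k i * C j i = 0" for i
      using Suc.IH[of i] low[of i k] Suc.prems by (cases "i + b < k") auto
    then show ?case by (simp add: CSuc)
  qed (simp add: C0)
  have C: "tp C"
  proof (rule tp_output[of "\<lambda>i j. Q j i" C])
    fix n
    have "C (Suc j) k = (\<Sum>i<n * b + 1. C j i * Q k i)" if "j < n" for j k
    proof -
      have "j * b \<le> n * b" using that by simp
      then have Cz: "C j i = 0" if "n * b + 1 \<le> i" for i
        using that by (intro C_eq_0) linarith
      have "C (Suc j) k = (\<Sum>i<k + 2 + (n * b + 1). Q k i * C j i)"
        unfolding CSuc by (rule sum_lessThan_cong_support[symmetric]) (auto simp: up)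
      also have "\<dots> = (\<Sum>i<n * b + 1. Q k i * C j i)"
        by (intro sum_lessThan_cong_support) (simp_all only: Cz mult_zero_right le_add2)
      finally show ?thesis by (simp add: mult.commute)
    qed
    then show "\<exists>K. \<forall>i<n. \<forall>j. C (Suc i) j = (\<Sum>k<K. C i k * Q j k)" by blast
  qed (fact tp_transpose[OF Q] C0)+
  \<comment> \<open>The induction moves one factor \<open>Q\<close> at a time from \<open>T\<close>
    over to \<open>C\<close>.\<close>
  have split: "T (i + j) 0 = (\<Sum>k<Suc i. T i k * C j k)" for i j
  proof (induction j arbitrary: i)
    case 0
    have "(\<Sum>k<Suc i. T i k * C 0 k) = (\<Sum>k\<in>{0}. T i k * C 0 k)"
      by (rule sum.mono_neutral_right) (auto simp: C0)
    then show ?case by (simp add: C0)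
  next
    case (Suc j)
    have "T (i + Suc j) 0 = (\<Sum>k<Suc (Suc i). T (Suc i) k * C j k)"
      using Suc.IH[of "Suc i"] by simp
    also have "\<dots> = (\<Sum>k<Suc (Suc i). \<Sum>l<Suc i. T i l * (Q l k * C j k))"
      by (simp only: TSuc sum_distrib_right mult.assoc)
    also have "\<dots> = (\<Sum>l<Suc i. T i l * (\<Sum>k<Suc (Suc i). Q l k * C j k))"
      by (subst sum.swap) (simp only: sum_distrib_left)
    also have "\<dots> = (\<Sum>l<Suc i. T i l * C (Suc j) l)"
      by (intro sum.cong refl arg_cong2[of _ _ _ _ "(*)"], unfold CSuc)
         (rule sum_lessThan_cong_support, auto simp: up)
    finally show ?case .
  qed
  show "tp (\<lambda>i j. T (i + j) 0)"
  proof (rule tp_mult[of T "\<lambda>i j. C j i"])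
    fix n
    have "T (i + j) 0 = (\<Sum>k<n. T i k * C j k)" if "i < n" for i j
      by (simp only: T_sum[OF Suc_leI[OF that]] split)
    then show "\<exists>K. \<forall>i<n. \<forall>j. T (i + j) 0 = (\<Sum>k<K. T i k * C j k)" by blast
  qed (fact T tp_transpose[OF C])+
qed

end

subsection \<open>The production matrix of the binomial row-generating matrix\<close>

lemma J_beta_0 [simp]: "J_beta P 0 = 0"
  by (simp add: J_beta_def)

text \<open>The recurrence read forwards, by where each entry of row \<open>n\<close> contributes.
  The truncated \<open>j - 1\<close> at \<open>j = 0\<close> is harmless because
  \<open>J_beta P 0 = 0\<close>.\<close>

lemma sum_J_mat_Suc:
  fixes g :: "nat \<Rightarrow> 'a::comm_ring_1"
  shows "(\<Sum>k\<le>Suc n. J_mat P (Suc n) k * g k) =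
    (\<Sum>j\<le>n. J_mat P n j * (J_delta P j * g (Suc j) + J_gamma P j * g j + J_beta P j * g (j - 1)))"
proof -
  have 1: "(\<Sum>k\<le>Suc n. (if k = 0 then 0 else J_delta P (k - 1) * J_mat P n (k - 1)) * g k) =
    (\<Sum>j\<le>n. J_mat P n j * (J_delta P j * g (Suc j)))"
    by (subst sum.atMost_Suc_shift) (simp add: mult_ac)
  have 2: "(\<Sum>k\<le>Suc n. J_gamma P k * J_mat P n k * g k) = (\<Sum>j\<le>n. J_mat P n j * (J_gamma P j * g j))"
    by (simp add: J_mat_eq_0 mult_ac)
  let ?F = "\<lambda>j. J_beta P j * J_mat P n j * g (j - 1)"
  have "(\<Sum>k\<le>Suc n. J_beta P (k + 1) * J_mat P n (k + 1) * g k) = (\<Sum>j\<le>Suc (Suc n). ?F j)"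
    by (subst sum.atMost_Suc_shift) simp
  also have "\<dots> = (\<Sum>j\<le>n. J_mat P n j * (J_beta P j * g (j - 1)))"
    by (simp add: J_mat_eq_0 mult_ac)
  finally have 3: "(\<Sum>k\<le>Suc n. J_beta P (k + 1) * J_mat P n (k + 1) * g k) =
    (\<Sum>j\<le>n. J_mat P n j * (J_beta P j * g (j - 1)))" .
  show ?thesis
    unfolding distrib_left sum.distrib 1[symmetric] 2[symmetric] 3[symmetric]
    by (simp only: J_mat.simps distrib_right sum.distrib)
qed

lemma binomial_mat_eq_0: "n < k \<Longrightarrow> binomial_mat q n k = 0"
  by (simp add: binomial_mat_def binomial_eq_0)

text \<open>Encode row \<open>j\<close> as the polynomial (z + q)^j. Then this is multiplication by
  z + q, \<open>binomial_mat_pred\<close> is differentiation in z, and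
  \<open>binomial_mat_index\<close> is the Euler-type operator (z + q) d/dz.\<close>

lemma binomial_mat_Suc:
  "binomial_mat q (Suc j) k =
    q * binomial_mat q j k + (if k = 0 then 0 else binomial_mat q j (k - 1))"
proof (cases k)
  case (Suc l)
  have "of_nat (j choose Suc l) * q ^ (j - l) = q * (of_nat (j choose Suc l) * q ^ (j - Suc l))"
  proof (cases "l < j")
    case True
    then have "q ^ (j - l) = q * q ^ (j - Suc l)" by (metis Suc_diff_Suc power_Suc)
    then show ?thesis by (simp add: mult_ac)
  qed (simp add: binomial_eq_0)
  then show ?thesis by (simp add: Suc binomial_mat_def algebra_simps)
qed (simp add: binomial_mat_def mult_ac)

lemma binomial_mat_pred:
  "of_nat j * binomial_mat q (j - 1) k = of_nat (Suc k) * binomial_mat q j (Suc k)"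
proof (cases j)
  case (Suc i)
  have "of_nat (Suc i) * of_nat (i choose k) = (of_nat (Suc k) * of_nat (Suc i choose Suc k) :: 'a)"
    by (simp only: of_nat_mult[symmetric] Suc_times_binomial_eq mult.commute)
  then show ?thesis
    unfolding Suc binomial_mat_def mult.assoc[symmetric] by simp
qed (simp add: binomial_mat_def)

lemma binomial_mat_index:
  fixes q :: "'a::comm_ring_1"
  shows "of_nat j * binomial_mat q j k =
    of_nat k * binomial_mat q j k + q * of_nat (Suc k) * binomial_mat q j (Suc k)"
proof (cases "k < j")
  case True
  have q: "q ^ (j - k) = q * q ^ (j - Suc k)"
    using True by (metis Suc_diff_Suc power_Suc)
  have "Suc k * (j choose Suc k) = (j - k) * (j choose k)"
    using True binomial_absorb_comp[of j k] binomial_absorption[of k j] by simp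
  then have "j * (j choose k) = k * (j choose k) + Suc k * (j choose Suc k)"
    using True by (simp add: diff_mult_distrib)
  then have "of_nat j * of_nat (j choose k) =
      (of_nat k * of_nat (j choose k) + of_nat (Suc k) * of_nat (j choose Suc k) :: 'a)"
    by (simp only: of_nat_mult[symmetric] of_nat_add[symmetric])
  then have "of_nat j * of_nat (j choose k) * (q * q ^ (j - Suc k)) =
      (of_nat k * of_nat (j choose k) + of_nat (Suc k) * of_nat (j choose Suc k))
        * (q * q ^ (j - Suc k))"
    by simp
  then show ?thesis
    unfolding binomial_mat_def q by (simp only: algebra_simps)
next
  case False
  then show ?thesis by (cases "j = k") (auto simp: binomial_mat_def binomial_eq_0)
qed

text \<open>With \<open>J_mat\<close> written as the output of \<open>U L\<close> for the bidiagonal matrices \<open>U\<close> and \<open>L\<close> with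
  entries \<open>U i i = x i + y\<close>, \<open>U i (i+1) = u (i+1) + v\<close>, \<open>L i i = a i + b\<close>, \<open>L (i+1) i = c (i+1)\<close>,
  these are the conjugates of \<open>L\<close> and \<open>U\<close> by the binomial matrix.\<close>

definition conj_L :: "'a::comm_ring_1 params \<Rightarrow> 'a \<Rightarrow> nat \<Rightarrow> nat \<Rightarrow> 'a" where
  "conj_L P q i j =
    (if i = j then pa P * of_nat j + pb P
     else if i = Suc j then (pa P * q + pc P) * of_nat (Suc j) else 0)"

definition conj_U :: "'a::comm_ring_1 params \<Rightarrow> 'a \<Rightarrow> nat \<Rightarrow> nat \<Rightarrow> 'a" where
  "conj_U P q i j =
    (if j = Suc i then pu P * of_nat j + pv P
     else if i = j then (px P + pu P * q) * of_nat j + q * (pu P * of_nat (Suc j) + pv P) + py P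
     else if i = Suc j then (px P + pu P * q) * q * of_nat (Suc j) else 0)"

definition prod_mat :: "'a::comm_ring_1 params \<Rightarrow> 'a \<Rightarrow> nat \<Rightarrow> nat \<Rightarrow> 'a" where
  "prod_mat P q i j = (\<Sum>k<i + 2. conj_U P q i k * conj_L P q k j)"

text \<open>An entry of the intertwining relation \<open>L B = B conj_L\<close>: the binomial
  identities trade the row index \<open>j\<close> for column indices.\<close>

lemma conj_L_binomial:
  "(pa P * of_nat j + pb P) * binomial_mat q j k + pc P * of_nat j * binomial_mat q (j - 1) k =
    binomial_mat q j k * conj_L P q k k + binomial_mat q j (Suc k) * conj_L P q (Suc k) k"
  (is "?l = _")
proof -
  have "?l = pa P * (of_nat j * binomial_mat q j k) + pb P * binomial_mat q j k
      + pc P * (of_nat j * binomial_mat q (j - 1) k)"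
    by (simp add: algebra_simps)
  then show ?thesis
    unfolding binomial_mat_index[of j q k] binomial_mat_pred conj_L_def
    by (simp add: algebra_simps)
qed

text \<open>An entry of \<open>U B = B conj_U\<close>. Here the rule of Pascal is needed as well, to
  bring row \<open>Suc j\<close> of \<open>B\<close> back to row \<open>j\<close>.\<close>

lemma conj_U_binomial:
  "(pu P * of_nat (Suc j) + pv P) * binomial_mat q (Suc j) k
      + (px P * of_nat j + py P) * binomial_mat q j k =
    (if k = 0 then 0 else binomial_mat q j (k - 1) * conj_U P q (k - 1) k)
      + binomial_mat q j k * conj_U P q k k + binomial_mat q j (Suc k) * conj_U P q (Suc k) k"
  (is "?l = ?r")
proof -
  have "?l = pu P * (of_nat (Suc j) * binomial_mat q (Suc j) k) + pv P * binomial_mat q (Suc j) k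
      + px P * (of_nat j * binomial_mat q j k) + py P * binomial_mat q j k"
    by (simp only: distrib_right mult.assoc add.assoc)
  also have "\<dots> = pu P * (of_nat k * binomial_mat q (Suc j) k
        + q * of_nat (Suc k) * binomial_mat q (Suc j) (Suc k))
      + pv P * binomial_mat q (Suc j) k
      + px P * (of_nat k * binomial_mat q j k + q * of_nat (Suc k) * binomial_mat q j (Suc k))
      + py P * binomial_mat q j k"
    by (simp only: binomial_mat_index[of j q k] binomial_mat_index[of "Suc j" q k])
  also have "\<dots> = ?r"
    unfolding binomial_mat_Suc conj_U_def
    by (cases k) (simp_all add: algebra_simps)
  finally show ?thesis .
qed

abbreviation (input) J_binomial :: "'a::comm_ring_1 params \<Rightarrow> 'a \<Rightarrow> nat \<Rightarrow> nat \<Rightarrow> 'a" where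
  "J_binomial P q \<equiv> lower_mult (J_mat P) (binomial_mat q)"

lemma J_binomial_0: "J_binomial P q 0 k = (if k = 0 then 1 else 0)"
  by (simp add: lower_mult_def binomial_mat_def binomial_eq_0)

lemma J_binomial_eq_0: "n < k \<Longrightarrow> J_binomial P q n k = 0"
  by (simp add: lower_mult_def binomial_mat_eq_0)

text \<open>One step of the recurrence multiplies by \<open>U L\<close>, and
  \<open>U L B = U B conj_L = B conj_U conj_L\<close>. The local \<open>X l\<close> is an entry of
  row \<open>n\<close> of \<open>J B conj_U\<close>.\<close>

lemma J_binomial_Suc_aux:
  "J_binomial P q (Suc n) k =
    (let X = \<lambda>l. (if l = 0 then 0 else J_binomial P q n (l - 1) * conj_U P q (l - 1) l)
       + J_binomial P q n l * conj_U P q l l + J_binomial P q n (Suc l) * conj_U P q (Suc l) l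
     in X k * conj_L P q k k + X (Suc k) * conj_L P q (Suc k) k)"
proof -
  let ?B = "binomial_mat q"
  let ?R = "\<lambda>j l. (if l = 0 then 0 else ?B j (l - 1) * conj_U P q (l - 1) l)
    + ?B j l * conj_U P q l l + ?B j (Suc l) * conj_U P q (Suc l) l"
  have "J_delta P j * ?B (Suc j) k + J_gamma P j * ?B j k + J_beta P j * ?B (j - 1) k =
      ?R j k * conj_L P q k k + ?R j (Suc k) * conj_L P q (Suc k) k" for j
  proof -
    \<comment> \<open>The factorization behind the three coefficients: row \<open>j\<close> of
      \<open>U\<close> weights rows \<open>Suc j\<close> and \<open>j\<close> of \<open>L\<close>,
      and \<open>J_delta\<close>, \<open>J_gamma\<close>, \<open>J_beta\<close> are the entries of
      row \<open>j\<close> of \<open>U L\<close>.\<close>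
    have "J_delta P j * ?B (Suc j) k + J_gamma P j * ?B j k + J_beta P j * ?B (j - 1) k =
      (pu P * of_nat (Suc j) + pv P) *
        ((pa P * of_nat (Suc j) + pb P) * ?B (Suc j) k + pc P * of_nat (Suc j) * ?B (Suc j - 1) k)
      + (px P * of_nat j + py P) *
        ((pa P * of_nat j + pb P) * ?B j k + pc P * of_nat j * ?B (j - 1) k)"
      by (simp add: J_delta_def J_gamma_def J_beta_def algebra_simps power2_eq_square)
    also have "\<dots> = ((pu P * of_nat (Suc j) + pv P) * ?B (Suc j) k
        + (px P * of_nat j + py P) * ?B j k) * conj_L P q k k
      + ((pu P * of_nat (Suc j) + pv P) * ?B (Suc j) (Suc k)
        + (px P * of_nat j + py P) * ?B j (Suc k)) * conj_L P q (Suc k) k"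
      unfolding conj_L_binomial by (simp only: algebra_simps)
    finally show ?thesis unfolding conj_U_binomial .
  qed
  then have "J_binomial P q (Suc n) k = (\<Sum>j\<le>n. J_mat P n j *
      (?R j k * conj_L P q k k + ?R j (Suc k) * conj_L P q (Suc k) k))"
    unfolding lower_mult_def sum_J_mat_Suc by simp
  then show ?thesis
    unfolding Let_def lower_mult_def
    by (cases k) (simp_all only: if_True if_False distrib_left distrib_right sum.distrib
        sum_distrib_right mult.assoc mult_zero_right mult_zero_left add_0_left simp_thms nat.distinct
        diff_Suc_1 diff_zero)
qed

lemma prod_mat_eq_0_upper: "Suc i < j \<Longrightarrow> prod_mat P q i j = 0"
  by (auto simp: prod_mat_def conj_L_def intro!: sum.neutral)

lemma prod_mat_eq_0_lower: "j + 2 < i \<Longrightarrow> prod_mat P q i j = 0"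
  by (auto simp: prod_mat_def conj_L_def conj_U_def intro!: sum.neutral)

lemma J_binomial_Suc:
  "J_binomial P q (Suc n) k = (\<Sum>i<Suc n. J_binomial P q n i * prod_mat P q i k)"
proof -
  let ?W = "J_binomial P q n" and ?U = "conj_U P q" and ?L = "conj_L P q"
  define N where "N = n + k + 4"
  have X: "(\<Sum>i<N. ?W i * ?U i l) =
      (if l = 0 then 0 else ?W (l - 1) * ?U (l - 1) l) + ?W l * ?U l l + ?W (Suc l) * ?U (Suc l) l"
    if "l < k + 2" for l
  proof -
    have "(\<Sum>i<N. ?W i * ?U i l) =
        (\<Sum>i\<in>(if l = 0 then {} else {l - 1}) \<union> {l, Suc l}. ?W i * ?U i l)"
      using that by (intro sum.mono_neutral_right) (auto simp: N_def conj_U_def)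
    then show ?thesis by (cases l) (auto simp: add_ac)
  qed
  have "(\<Sum>i<Suc n. ?W i * prod_mat P q i k) = (\<Sum>i<N. ?W i * prod_mat P q i k)"
    by (rule sum_lessThan_cong_support[symmetric]) (auto simp: J_binomial_eq_0 N_def)
  also have "\<dots> = (\<Sum>i<N. \<Sum>l<N + 1. ?W i * ?U i l * ?L l k)"
  proof (rule sum.cong)
    fix i assume "i \<in> {..<N}"
    then have "prod_mat P q i k = (\<Sum>l<N + 1. ?U i l * ?L l k)"
      unfolding prod_mat_def
      by (intro sum_lessThan_cong_support[symmetric]) (auto simp: conj_U_def)
    then show "?W i * prod_mat P q i k = (\<Sum>l<N + 1. ?W i * ?U i l * ?L l k)"
      by (simp only: sum_distrib_left mult.assoc)
  qed simp
  also have "\<dots> = (\<Sum>l<N + 1. (\<Sum>i<N. ?W i * ?U i l) * ?L l k)"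
    by (subst sum.swap) (simp only: sum_distrib_right)
  also have "\<dots> = (\<Sum>l\<in>{k, Suc k}. (\<Sum>i<N. ?W i * ?U i l) * ?L l k)"
    by (rule sum.mono_neutral_right) (auto simp: N_def conj_L_def)
  also have "\<dots> = (\<Sum>i<N. ?W i * ?U i k) * ?L k k + (\<Sum>i<N. ?W i * ?U i (Suc k)) * ?L (Suc k) k"
    by simp
  also have "\<dots> = J_binomial P q (Suc n) k"
    by (subst (1 2) X) (simp_all add: J_binomial_Suc_aux Let_def)
  finally show ?thesis by simp
qed

lemma J_binomial_column_0: "J_binomial P q n 0 = J_row P q n"
  by (simp add: lower_mult_def J_row_def binomial_mat_def)

context positivity
begin

definition pos_params :: "'a params \<Rightarrow> bool" where
  "pos_params P \<longleftrightarrow> pos (pa P) \<and> pos (pb P) \<and> pos (pc P) \<and> pos (pu P) \<and> pos (pv P) \<and>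
    pos (px P) \<and> pos (py P)"

lemma tp_prod_mat:
  assumes "pos_params P" "pos q"
  shows "tp (prod_mat P q)"
proof (rule tp_mult[of "conj_U P q" "conj_L P q"])
  have P: "pos (pa P)" "pos (pb P)" "pos (pc P)" "pos (pu P)" "pos (pv P)" "pos (px P)" "pos (py P)"
    using assms by (auto simp: pos_params_def)
  show "tp (conj_L P q)"
    by (rule tp_tridiagonal[where e = "\<lambda>i. pa P * of_nat i + pb P" and h = "\<lambda>_. 0" and w = "\<lambda>_. 0"])
       (use P \<open>pos q\<close> in \<open>auto simp: conj_L_def simp del: of_nat_Suc\<close>)
  \<comment> \<open>\<open>h i\<close> is \<open>q\<close> times the superdiagonal entry and
    \<open>q * e (Suc i)\<close> is the subdiagonal entry, so the products agree; the diagonal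
    weight left over is \<open>py P\<close>.\<close>
  show "tp (conj_U P q)"
    by (rule tp_tridiagonal[where e = "\<lambda>i. (px P + pu P * q) * of_nat i" and
          h = "\<lambda>i. q * (pu P * of_nat (Suc i) + pv P)" and w = "\<lambda>_. py P"])
       (use P \<open>pos q\<close> in \<open>auto simp: conj_U_def mult_ac simp del: of_nat_Suc\<close>)
  fix n
  have "prod_mat P q i j = (\<Sum>k<n + 1. conj_U P q i k * conj_L P q k j)" if "i < n" for i j
    unfolding prod_mat_def using that
    by (intro sum_lessThan_cong_support[symmetric]) (auto simp: conj_U_def)
  then show "\<exists>K. \<forall>i<n. \<forall>j. prod_mat P q i j = (\<Sum>k<K. conj_U P q i k * conj_L P q k j)" by blast
qed

lemma
  assumes "pos_params P" "pos q"
  shows tp_J_binomial: "tp (J_binomial P q)"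
    and hankel_tp_J_row: "tp (\<lambda>i j. J_row P q (i + j))"
  using hankel_tp_production[of "prod_mat P q" 2 "J_binomial P q"] tp_prod_mat[OF assms]
  unfolding J_binomial_column_0[symmetric]
  by (auto simp: prod_mat_eq_0_upper prod_mat_eq_0_lower J_binomial_0 J_binomial_Suc)

end

subsection \<open>Reversal and the first column\<close>

definition scale_params :: "'a::comm_semiring_1 \<Rightarrow> 'a params \<Rightarrow> 'a params" where
  "scale_params t P = P\<lparr>pc := pc P * t, px := px P * t, py := py P * t\<rparr>"

text \<open>The scaling multiplies \<open>J_delta\<close>, \<open>J_gamma\<close>,
  \<open>J_beta\<close> by 1, \<open>t\<close> and \<open>t^2\<close>. These belong to column steps
  +1, 0, -1, so each step contributes one minus its displacement and \<open>n\<close> steps from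
  column 0 to \<open>k\<close> collect \<open>t ^ (n - k)\<close>.\<close>

lemma J_mat_scale_params: "k \<le> n \<Longrightarrow> J_mat (scale_params t P) n k = J_mat P n k * t ^ (n - k)"
  for P :: "'a::comm_ring_1 params"
proof (induction n arbitrary: k)
  case 0
  then show ?case by simp
next
  case (Suc n)
  have dgb: "J_delta (scale_params t P) i = J_delta P i" "J_gamma (scale_params t P) i = J_gamma P i * t"
    "J_beta (scale_params t P) i = J_beta P i * t ^ 2" for i
    by (auto simp: J_delta_def J_gamma_def J_beta_def scale_params_def algebra_simps power2_eq_square)
  have 1: "J_mat (scale_params t P) n (k - 1) = J_mat P n (k - 1) * t ^ (Suc n - k)" if "k \<noteq> 0"
    using Suc that by (simp add: Suc_diff_le)
  have 2: "J_mat (scale_params t P) n k * t = J_mat P n k * t ^ (Suc n - k)"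
  proof (cases "k \<le> n")
    case True
    then show ?thesis using Suc.IH[of k] by (simp add: Suc_diff_le mult_ac)
  qed (simp add: J_mat_eq_0)
  have 3: "J_mat (scale_params t P) n (k + 1) * t ^ 2 = J_mat P n (k + 1) * t ^ (Suc n - k)"
  proof (cases "k + 1 \<le> n")
    case True
    then have "Suc n - k = n - (k + 1) + 2" by simp
    then show ?thesis using Suc.IH[of "k + 1"] True by (simp only: power_add mult_ac)
  qed (simp add: J_mat_eq_0)
  have "J_mat (scale_params t P) (Suc n) k =
     (if k = 0 then 0 else J_delta P (k - 1) * J_mat (scale_params t P) n (k - 1))
     + J_gamma P k * (J_mat (scale_params t P) n k * t)
     + J_beta P (k + 1) * (J_mat (scale_params t P) n (k + 1) * t ^ 2)"
    by (simp only: J_mat.simps dgb mult_ac)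
  also have "\<dots> = J_mat P (Suc n) k * t ^ (Suc n - k)"
    unfolding 2 3 using 1 by (cases "k = 0") (simp_all add: algebra_simps)
  finally show ?case .
qed

text \<open>This homogeneous form serves twice: \<open>q = 1\<close> yields the reversed
  polynomials, and two nonnegative reals yield the expression that is integrated for the
  convolution.\<close>

lemma J_row_scale_params: "J_row (scale_params t P) q n = (\<Sum>k\<le>n. J_mat P n k * q ^ k * t ^ (n - k))"
  for P :: "'a::comm_ring_1 params"
  by (simp add: J_row_def J_mat_scale_params mult_ac)

lemma J_row_rev_eq_J_row: "J_row_rev P q n = J_row (scale_params q P) 1 n"
  for P :: "'a::comm_ring_1 params"
  by (simp add: J_row_scale_params J_row_rev_def)

lemma J_row_0: "J_row P 0 n = J_mat P n 0"
proof -
  have "J_row P 0 n = (\<Sum>k\<in>{0}. J_mat P n k * 0 ^ k)"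
    unfolding J_row_def by (rule sum.mono_neutral_right) (auto simp: power_0_left)
  then show ?thesis by simp
qed

lemma (in positivity) pos_params_scale_params:
  "pos_params P \<Longrightarrow> pos t \<Longrightarrow> pos_params (scale_params t P)"
  by (auto simp: pos_params_def scale_params_def)

section \<open>The two positive cones: polynomials and real numbers\<close>

interpretation mpol: positivity "nonneg_coeffs :: 'v mpol \<Rightarrow> bool"
proof
  fix p q :: "'v mpol" assume "nonneg_coeffs p" "nonneg_coeffs q"
  then show "nonneg_coeffs (p * q)"
    unfolding nonneg_coeffs_def lookup_mult Sum_any.expand_set
    by (auto intro!: sum_nonneg mult_nonneg_nonneg simp: when_def)
qed (auto simp: nonneg_coeffs_def lookup_add lookup_one when_def)

interpretation nonneg_real: positivity "\<lambda>r::real. 0 \<le> r"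
  by standard auto

lemma nonneg_coeffs_indet: "nonneg_coeffs (indet v)"
  by (auto simp: nonneg_coeffs_def indet_def lookup_single when_def)

lemma pos_params_indet_params: "mpol.pos_params (indet_params e)"
  by (simp add: mpol.pos_params_def indet_params_def nonneg_coeffs_indet)

lemma coeff_totally_positive_iff: "coeff_totally_positive M \<longleftrightarrow> mpol.tp M"
  by (simp add: coeff_totally_positive_def mpol.tp_def)

subsection \<open>Log-convexity from Hankel-total positivity\<close>

context positivity
begin

text \<open>Dodgson condensation: writing \<open>d2\<close>, \<open>d3\<close>, \<open>d4\<close> for the Hankel determinants centred at \<open>i\<close>,
  one has \<open>L\<^sup>2 f i = f i * d3 i\<close> and \<open>d3 (i - 1) * d3 (i + 1) - (d3 i)\<^sup>2 = d4 i * d2 i\<close>.\<close>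

lemma log_convex_3_if_hankel_tp:
  assumes H: "tp (\<lambda>i j. f (i + j))" and "k \<le> 3" "k \<le> i"
  shows "pos ((log_convex_op ^^ k) f i)"
proof -
  define d where "d m n = matrix_minor (\<lambda>i j. f (i + j)) m (\<lambda>j. j) (\<lambda>j. n + j)" for m n
  have pos_d: "pos (d m n)" for m n
    unfolding d_def by (rule tpD[OF H]) (auto intro!: strict_mono_onI)
  have d1: "d 1 n = f n" for n by (simp add: d_def)
  have d2: "d 2 n = f n * f (n + 2) - (f (n + 1))\<^sup>2" for n
    by (simp add: d_def matrix_minor_expand_first_row numeral_eq_Suc insert_index_def)
  have d3: "d 3 n = f n * (f (n + 2) * f (n + 4) - f (n + 3) * f (n + 3))
      - f (n + 1) * (f (n + 1) * f (n + 4) - f (n + 3) * f (n + 2))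
      + f (n + 2) * (f (n + 1) * f (n + 3) - f (n + 2) * f (n + 2))" for n
    by (simp add: d_def matrix_minor_expand_first_row numeral_eq_Suc insert_index_def algebra_simps)
  have d4: "d 4 n =
     f n * (f (n + 2) * (f (n + 4) * f (n + 6) - f (n + 5) * f (n + 5))
       - f (n + 3) * (f (n + 3) * f (n + 6) - f (n + 5) * f (n + 4))
       + f (n + 4) * (f (n + 3) * f (n + 5) - f (n + 4) * f (n + 4)))
     - f (n + 1) * (f (n + 1) * (f (n + 4) * f (n + 6) - f (n + 5) * f (n + 5))
       - f (n + 3) * (f (n + 2) * f (n + 6) - f (n + 5) * f (n + 3))
       + f (n + 4) * (f (n + 2) * f (n + 5) - f (n + 4) * f (n + 3)))
     + f (n + 2) * (f (n + 1) * (f (n + 3) * f (n + 6) - f (n + 5) * f (n + 4))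
       - f (n + 2) * (f (n + 2) * f (n + 6) - f (n + 5) * f (n + 3))
       + f (n + 4) * (f (n + 2) * f (n + 4) - f (n + 3) * f (n + 3)))
     - f (n + 3) * (f (n + 1) * (f (n + 3) * f (n + 5) - f (n + 4) * f (n + 4))
       - f (n + 2) * (f (n + 2) * f (n + 5) - f (n + 4) * f (n + 3))
       + f (n + 3) * (f (n + 2) * f (n + 4) - f (n + 3) * f (n + 3)))" for n
    by (simp add: d_def matrix_minor_expand_first_row numeral_eq_Suc insert_index_def algebra_simps)
  have op1: "log_convex_op f (n + 1) = d 2 n" for n
    by (simp add: log_convex_op_def d2)
  have ix: "n + 2 + 1 = n + 3" "n + 2 + 2 = n + 4" "n + 2 + 3 = n + 5" "n + 2 + 4 = n + 6"
    "n + 1 + 1 = n + 2" "n + 1 + 2 = n + 3" "n + 1 + 3 = n + 4" "n + 1 + 4 = n + 5" for n :: nat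
    by simp_all
  have op2: "(log_convex_op ^^ 2) f (n + 2) = f (n + 2) * d 3 n" for n
  proof -
    have "(log_convex_op ^^ 2) f (n + 2) = d 2 n * d 2 (n + 2) - (d 2 (n + 1))\<^sup>2"
      using op1[of n] op1[of "n + 1"] op1[of "n + 2"]
      by (simp add: numeral_eq_Suc log_convex_op_def[of "log_convex_op f"])
    also have "\<dots> = f (n + 2) * d 3 n"
      unfolding d2 d3 ix by (simp only: algebra_simps power2_eq_square)
    finally show ?thesis .
  qed
  have op3: "(log_convex_op ^^ 3) f (n + 3) = d 2 (n + 2) * (d 3 n * d 3 (n + 2))
      + (f (n + 3))\<^sup>2 * (d 4 n * d 2 (n + 2))" for n
  proof -
    have "(log_convex_op ^^ 3) f (n + 3) = log_convex_op ((log_convex_op ^^ 2) f) (n + 3)"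
      by (simp add: numeral_eq_Suc)
    also have "\<dots> = f (n + 2) * d 3 n * (f (n + 4) * d 3 (n + 2)) - (f (n + 3) * d 3 (n + 1))\<^sup>2"
    proof -
      have "n + 3 - 1 = n + 2" "n + 3 + 1 = n + 4" by simp_all
      then show ?thesis
        by (simp only: log_convex_op_def[of "(log_convex_op ^^ 2) f"] op2[of n]
            op2[of "n + 1", unfolded ix] op2[of "n + 2", unfolded ix])
    qed
    \<comment> \<open>Replacing \<open>f (n + 2) * f (n + 4)\<close> by
      \<open>d 2 (n + 2) + (f (n + 3))^2\<close> isolates the Dodgson difference of the
      \<open>d 3\<close>.\<close>
    also have "\<dots> = d 2 (n + 2) * (d 3 n * d 3 (n + 2))
        + (f (n + 3))\<^sup>2 * (d 3 n * d 3 (n + 2) - (d 3 (n + 1))\<^sup>2)"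
      unfolding d2 ix by (simp only: algebra_simps power2_eq_square)
    also have "d 3 n * d 3 (n + 2) - (d 3 (n + 1))\<^sup>2 = d 4 n * d 2 (n + 2)"
      unfolding d2 d3 d4 ix by (simp only: algebra_simps power2_eq_square)
    finally show ?thesis .
  qed
  have pos_f: "pos (f n)" for n using pos_d[of 1 n] by (simp only: d1)
  obtain n where i: "i = n + k" using \<open>k \<le> i\<close> by (metis add.commute le_add_diff_inverse)
  consider "k = 0" | "k = 1" | "k = 2" | "k = 3" using \<open>k \<le> 3\<close> by linarith
  then show ?thesis
  proof cases
    case 1
    then show ?thesis by (simp add: pos_f)
  next
    case 2
    then show ?thesis using op1[of n] pos_d[of 2 n] i by simp
  next
    case 3
    have "pos (f (n + 2) * d 3 n)" by (intro pos_mult pos_f pos_d)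
    then show ?thesis using op2[of n] i 3 by simp
  next
    case 4
    have "pos (d 2 (n + 2) * (d 3 n * d 3 (n + 2)) + (f (n + 3))\<^sup>2 * (d 4 n * d 2 (n + 2)))"
      by (intro pos_add pos_mult pos_power pos_f pos_d)
    then show ?thesis using op3[of n] i 4 by simp
  qed
qed

end

lemma hankel_tp_imp_coeff_positive:
  assumes "mpol.tp (\<lambda>i j. f (i + j))"
  shows "coeff_hankel_totally_positive f" "coeff_log_convex 3 f"
  using assms mpol.log_convex_3_if_hankel_tp[of f]
  by (auto simp: coeff_hankel_totally_positive_def coeff_totally_positive_iff coeff_log_convex_def)

subsection \<open>Positive semidefiniteness from principal minors\<close>

text \<open>One step of Gaussian elimination: the unitriangular \<open>?L\<close> clears the first
  column below the pivot without changing the determinant.\<close>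

lemma matrix_minor_Schur:
  fixes M :: "nat \<Rightarrow> nat \<Rightarrow> 'a::field"
  assumes p: "M (r 0) (s 0) \<noteq> 0"
  shows "matrix_minor M (Suc m) r s = M (r 0) (s 0) *
    matrix_minor (\<lambda>i j. M i j - M i (s 0) * M (r 0) j / M (r 0) (s 0)) m (r \<circ> Suc) (s \<circ> Suc)"
proof -
  let ?p = "M (r 0) (s 0)" and ?n = "Suc m"
  let ?A = "Matrix.mat ?n ?n (\<lambda>(i, j). M (r i) (s j))"
  let ?L = "Matrix.mat ?n ?n (\<lambda>(i, j). if i = j then 1 else if j = 0 then - M (r i) (s 0) / ?p else 0)"
  let ?N = "\<lambda>i j. if i = 0 then M (r 0) (s j) else M (r i) (s j) - M (r i) (s 0) * M (r 0) (s j) / ?p"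
  have "Determinant.det ?L = prod_list (diag_mat ?L)"
    by (rule det_lower_triangular[of ?n]) auto
  also have "\<dots> = 1"
    by (simp add: prod_list_diag_prod)
  finally have L: "Determinant.det ?L = 1" .
  have prod: "?L * ?A = Matrix.mat ?n ?n (\<lambda>(i, j). ?N i j)"
  proof (rule eq_matI)
    fix i j assume "i < dim_row (Matrix.mat ?n ?n (\<lambda>(i, j). ?N i j))"
      "j < dim_col (Matrix.mat ?n ?n (\<lambda>(i, j). ?N i j))"
    then have ij: "i < ?n" "j < ?n" by auto
    have "(?L * ?A) $$ (i, j) = (\<Sum>k\<in>{0..<?n}. ?L $$ (i, k) * ?A $$ (k, j))"
      using ij by (simp add: scalar_prod_def)
    also have "\<dots> = (\<Sum>k\<in>{0, i}. ?L $$ (i, k) * ?A $$ (k, j))"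
      using ij by (intro sum.mono_neutral_right) auto
    also have "\<dots> = ?N i j" using ij by auto
    finally show "(?L * ?A) $$ (i, j) = Matrix.mat ?n ?n (\<lambda>(i, j). ?N i j) $$ (i, j)"
      using ij by simp
  qed auto
  have "matrix_minor M ?n r s = Determinant.det (?L * ?A)"
    by (subst det_mult[of _ ?n]) (auto simp: L matrix_minor_def)
  also have "\<dots> = matrix_minor ?N ?n (\<lambda>i. i) (\<lambda>i. i)"
    by (simp add: prod matrix_minor_def)
  also have "\<dots> = matrix_minor ?N 1 (\<lambda>i. i) (\<lambda>i. i) *
      matrix_minor ?N (?n - 1) (\<lambda>i. i + 1) (\<lambda>i. i + 1)"
    using p by (intro matrix_minor_block') auto
  also have "matrix_minor ?N (?n - 1) (\<lambda>i. i + 1) (\<lambda>i. i + 1) =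
      matrix_minor (\<lambda>i j. M i j - M i (s 0) * M (r 0) j / ?p) m (r \<circ> Suc) (s \<circ> Suc)"
    by (simp, rule matrix_minor_cong) simp
  finally show ?thesis by simp
qed

text \<open>If the corner entry is positive, completing the square leaves the Schur complement,
  whose principal minors are again nonnegative. If it is 0, the minors of order 2 force the first
  row to vanish.\<close>

lemma psd_if_principal_minors_nonneg:
  fixes M :: "nat \<Rightarrow> nat \<Rightarrow> real"
  assumes "\<And>i j. M i j = M j i"
    and "\<And>m r. strict_mono_on {..<m} r \<Longrightarrow> 0 \<le> matrix_minor M m r r"
  shows "0 \<le> (\<Sum>i<n. \<Sum>j<n. c i * c j * M i j)"
  using assms
proof (induction n arbitrary: M c)
  case 0
  then show ?case by simp
next
  case (Suc n)
  note sym = Suc.prems(1) and minors = Suc.prems(2)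
  define S where "S = (\<Sum>i<n. c (Suc i) * M 0 (Suc i))"
  define T where "T = (\<Sum>i<n. \<Sum>j<n. c (Suc i) * c (Suc j) * M (Suc i) (Suc j))"
  have expand: "(\<Sum>i<Suc n. \<Sum>j<Suc n. c i * c j * M i j) = c 0 * c 0 * M 0 0 + 2 * c 0 * S + T"
  proof -
    have S1: "(\<Sum>i<n. c 0 * c (Suc i) * M 0 (Suc i)) = c 0 * S"
      by (simp add: S_def sum_distrib_left mult_ac)
    have S2: "(\<Sum>i<n. c (Suc i) * c 0 * M (Suc i) 0) = c 0 * S"
      unfolding S_def sum_distrib_left
      by (intro sum.cong refl) (simp add: sym[of "Suc _" 0] mult_ac)
    show ?thesis
      by (simp only: sum.lessThan_Suc_shift sum.distrib S1 S2 T_def[symmetric])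
  qed
  have "0 \<le> matrix_minor M 1 (\<lambda>_. 0) (\<lambda>_. 0)"
    by (rule minors) (auto simp: strict_mono_on_def)
  then have "0 \<le> M 0 0" by simp
  then consider "M 0 0 = 0" | "M 0 0 > 0" by linarith
  then show ?case
  proof cases
    case 1
    have "M 0 (Suc i) = 0" for i
    proof -
      have "0 \<le> matrix_minor M 2 (\<lambda>j. if j = 0 then 0 else Suc i) (\<lambda>j. if j = 0 then 0 else Suc i)"
        by (rule minors) (auto simp: strict_mono_on_def)
      also have "\<dots> = - (M 0 (Suc i))\<^sup>2"
        using sym[of "Suc i" 0] 1
        by (simp add: matrix_minor_expand_first_row numeral_eq_Suc insert_index_def)
      finally show ?thesis by simp
    qed
    then have "S = 0" by (simp add: S_def)
    moreover have "0 \<le> T"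
      unfolding T_def
    proof (rule Suc.IH)
      fix m r assume "strict_mono_on {..<m} (r :: nat \<Rightarrow> nat)"
      then have "0 \<le> matrix_minor M m (\<lambda>i. Suc (r i)) (\<lambda>i. Suc (r i))"
        by (intro minors) (auto simp: strict_mono_on_def)
      also have "\<dots> = matrix_minor (\<lambda>i j. M (Suc i) (Suc j)) m r r"
        by (rule matrix_minor_cong) simp
      finally show "0 \<le> matrix_minor (\<lambda>i j. M (Suc i) (Suc j)) m r r" .
    qed (rule sym)
    ultimately show ?thesis unfolding expand using 1 by simp
  next
    case 2
    define M' where "M' i j = M (Suc i) (Suc j) - M (Suc i) 0 * M 0 (Suc j) / M 0 0" for i j
    have "0 \<le> (\<Sum>i<n. \<Sum>j<n. c (Suc i) * c (Suc j) * M' i j)"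
    proof (rule Suc.IH)
      fix m r assume r: "strict_mono_on {..<m} (r :: nat \<Rightarrow> nat)"
      \<comment> \<open>Adjoining index 0 turns a principal minor of the Schur complement into one
        of \<open>M\<close>, up to the positive factor \<open>M 0 0\<close>.\<close>
      let ?r = "\<lambda>j. case j of 0 \<Rightarrow> 0 | Suc k \<Rightarrow> Suc (r k)"
      have "0 \<le> matrix_minor M (Suc m) ?r ?r"
        using r by (intro minors) (auto simp: strict_mono_on_def split: nat.splits)
      also have "\<dots> = M 0 0 *
          matrix_minor (\<lambda>i j. M i j - M i 0 * M 0 j / M 0 0) m (?r \<circ> Suc) (?r \<circ> Suc)"
        using matrix_minor_Schur[of M ?r ?r m] 2 by simp
      also have "matrix_minor (\<lambda>i j. M i j - M i 0 * M 0 j / M 0 0) m (?r \<circ> Suc) (?r \<circ> Suc) =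
          matrix_minor M' m r r"
        by (rule matrix_minor_cong) (simp add: M'_def)
      finally show "0 \<le> matrix_minor M' m r r" using 2 by (simp add: zero_le_mult_iff)
    next
      fix i j show "M' i j = M' j i"
        unfolding M'_def using sym[of "Suc i" "Suc j"] sym[of 0 "Suc j"] sym[of "Suc i" 0] by simp
    qed
    also have "\<dots> = T - S * S / M 0 0"
    proof -
      have "S * S / M 0 0 = (\<Sum>i<n. \<Sum>j<n. c (Suc i) * c (Suc j) * (M (Suc i) 0 * M 0 (Suc j) / M 0 0))"
        unfolding S_def sum_product sum_divide_distrib
        by (intro sum.cong refl) (simp add: sym[of "Suc _" 0] mult_ac)
      then show ?thesis
        unfolding M'_def T_def right_diff_distrib sum_subtractf by simp
    qed
    finally have "0 \<le> T - S * S / M 0 0" .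
    moreover have "c 0 * c 0 * M 0 0 + 2 * c 0 * S + T =
        M 0 0 * (c 0 + S / M 0 0)\<^sup>2 + (T - S * S / M 0 0)"
      using 2 by (simp add: field_simps power2_eq_square)
    moreover have "0 \<le> M 0 0 * (c 0 + S / M 0 0)\<^sup>2" using 2 by simp
    ultimately show ?thesis unfolding expand by linarith
  qed
qed

definition psd_seq :: "(nat \<Rightarrow> real) \<Rightarrow> bool" where
  "psd_seq f \<longleftrightarrow> (\<forall>n c. 0 \<le> (\<Sum>i<n. \<Sum>j<n. c i * c j * f (i + j)))"

text \<open>A principal minor of the shifted Hankel matrix is a minor of the original one with
  columns moved by one, hence not principal there. Total positivity covers it, positive
  semidefiniteness alone would not.\<close>

lemma psd_seq_if_hankel_tp:
  assumes "nonneg_real.tp (\<lambda>i j. f (i + j))"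
  shows "psd_seq f" "psd_seq (\<lambda>n. f (Suc n))"
proof -
  have "0 \<le> (\<Sum>i<n. \<Sum>j<n. c i * c j * f (i + j))" for n and c :: "nat \<Rightarrow> real"
    by (rule psd_if_principal_minors_nonneg[of "\<lambda>i j. f (i + j)"])
       (auto simp: add.commute intro: nonneg_real.tpD[OF assms])
  then show "psd_seq f" by (simp add: psd_seq_def)
  have "0 \<le> (\<Sum>i<n. \<Sum>j<n. c i * c j * f (Suc (i + j)))" for n and c :: "nat \<Rightarrow> real"
  proof (rule psd_if_principal_minors_nonneg[of "\<lambda>i j. f (Suc (i + j))"])
    fix m r assume r: "strict_mono_on {..<m} (r :: nat \<Rightarrow> nat)"
    have "0 \<le> matrix_minor (\<lambda>i j. f (i + j)) m r (\<lambda>i. Suc (r i))"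
      using r by (intro nonneg_real.tpD[OF assms]) (auto simp: strict_mono_on_def)
    also have "\<dots> = matrix_minor (\<lambda>i j. f (Suc (i + j))) m r r"
      by (rule matrix_minor_cong) simp
    finally show "0 \<le> matrix_minor (\<lambda>i j. f (Suc (i + j))) m r r" .
  qed (simp add: add.commute)
  then show "psd_seq (\<lambda>n. f (Suc n))" by (simp add: psd_seq_def)
qed

subsection \<open>The linear functional of a moment sequence\<close>

text \<open>The Riesz functional of \<open>s\<close>, which is integration against a representing
  measure whenever there is one.\<close>

definition moment_fun :: "(nat \<Rightarrow> real) \<Rightarrow> real poly \<Rightarrow> real" where
  "moment_fun s p = (\<Sum>i\<le>degree p. coeff p i * s i)"

lemma moment_fun_eq: "degree p \<le> N \<Longrightarrow> moment_fun s p = (\<Sum>i\<le>N. coeff p i * s i)"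
  unfolding moment_fun_def by (rule sum.mono_neutral_left) (auto simp: coeff_eq_0)

lemma moment_fun_0 [simp]: "moment_fun s 0 = 0"
  by (simp add: moment_fun_def)

lemma moment_fun_add: "moment_fun s (p + q) = moment_fun s p + moment_fun s q"
proof -
  let ?N = "max (degree p) (degree q)"
  have "moment_fun s (p + q) = (\<Sum>i\<le>?N. coeff (p + q) i * s i)"
    by (rule moment_fun_eq) (rule degree_add_le_max)
  also have "\<dots> = moment_fun s p + moment_fun s q"
    by (simp add: moment_fun_eq[of p ?N] moment_fun_eq[of q ?N] distrib_right sum.distrib)
  finally show ?thesis .
qed

lemma moment_fun_smult: "moment_fun s (Polynomial.smult a p) = a * moment_fun s p"
  by (subst moment_fun_eq[of _ "degree p"])
     (auto simp: moment_fun_def sum_distrib_left mult_ac degree_smult_le)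

lemma moment_fun_diff: "moment_fun s (p - q) = moment_fun s p - moment_fun s q"
  using moment_fun_add[of s "p - q" q] by simp

lemma moment_fun_sum: "moment_fun s (sum f A) = (\<Sum>a\<in>A. moment_fun s (f a))"
  by (induction A rule: infinite_finite_induct) (auto simp: moment_fun_add)

lemma moment_fun_monom: "moment_fun s (monom a n) = a * s n"
proof -
  have "moment_fun s (monom a n) = (\<Sum>i\<le>n. coeff (monom a n) i * s i)"
    by (rule moment_fun_eq) (rule degree_monom_le)
  also have "\<dots> = (\<Sum>i\<in>{n}. coeff (monom a n) i * s i)"
    by (rule sum.mono_neutral_right) auto
  finally show ?thesis by simp
qed

lemma moment_fun_mult:
  "moment_fun s (p * q) = (\<Sum>i\<le>degree p. \<Sum>j\<le>degree q. coeff p i * coeff q j * s (i + j))"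
proof -
  have "p * q = (\<Sum>i\<le>degree p. monom (coeff p i) i) * (\<Sum>j\<le>degree q. monom (coeff q j) j)"
    by (simp add: poly_as_sum_of_monoms)
  also have "\<dots> = (\<Sum>i\<le>degree p. \<Sum>j\<le>degree q. monom (coeff p i * coeff q j) (i + j))"
    by (simp add: sum_product mult_monom)
  finally show ?thesis by (simp add: moment_fun_sum moment_fun_monom)
qed

text \<open>This ties positivity of the shifted sequence to polynomials of the form x g^2.\<close>

lemma moment_fun_pCons_0: "moment_fun s (pCons 0 p) = moment_fun (\<lambda>n. s (Suc n)) p"
proof -
  have "moment_fun s (pCons 0 p) = (\<Sum>i\<le>Suc (degree p). coeff (pCons 0 p) i * s i)"
    by (rule moment_fun_eq) (rule degree_pCons_le)
  also have "\<dots> = moment_fun (\<lambda>n. s (Suc n)) p"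
    by (subst sum.atMost_Suc_shift) (simp add: moment_fun_def)
  finally show ?thesis .
qed

lemma moment_fun_square_nonneg:
  assumes "psd_seq s"
  shows "0 \<le> moment_fun s (p * p)"
  using assms unfolding psd_seq_def moment_fun_mult lessThan_Suc_atMost[symmetric] by blast

text \<open>This is all that the convolution argument draws from a representing measure.\<close>

lemma moment_fun_nonneg:
  assumes "stieltjes_moment_seq s" and p: "\<And>x. 0 \<le> x \<Longrightarrow> 0 \<le> poly p x"
  shows "0 \<le> moment_fun s p"
proof -
  obtain \<mu> :: "real measure" where "sets \<mu> = sets borel"
    and int: "\<And>n. set_integrable \<mu> {0..} (\<lambda>x. x ^ n)"
    and s: "\<And>n. s n = set_lebesgue_integral \<mu> {0..} (\<lambda>x. x ^ n)"
    using assms(1) by (auto simp: stieltjes_moment_seq_def)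
  have "moment_fun s p =
      (\<Sum>i\<le>degree p. integral\<^sup>L \<mu> (\<lambda>x. coeff p i * (indicator {0..} x * x ^ i)))"
    unfolding moment_fun_def s set_lebesgue_integral_def by simp
  also have "\<dots> = integral\<^sup>L \<mu> (\<lambda>x. \<Sum>i\<le>degree p. coeff p i * (indicator {0..} x * x ^ i))"
    using int by (intro Bochner_Integration.integral_sum[symmetric]) (simp add: set_integrable_def)
  also have "\<dots> = integral\<^sup>L \<mu> (\<lambda>x. indicator {0..} x * poly p x)"
    by (simp add: poly_altdef sum_distrib_left mult_ac)
  also have "\<dots> \<ge> 0"
    using p by (intro Bochner_Integration.integral_nonneg) (auto simp: indicator_def)
  finally show ?thesis .
qed

text \<open>The inner inequality is first integrated in \<open>x\<close> for fixed \<open>y\<close>, then in \<open>y\<close>.\<close>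

lemma psd_seq_convolution:
  assumes s: "stieltjes_moment_seq s" and t: "stieltjes_moment_seq t"
    and psd: "\<And>x y. 0 \<le> x \<Longrightarrow> 0 \<le> y \<Longrightarrow> psd_seq (\<lambda>n. \<Sum>k\<le>n + e. C (n + e) k * x ^ k * y ^ (n + e - k))"
  shows "psd_seq (\<lambda>n. \<Sum>k\<le>n + e. C (n + e) k * s k * t (n + e - k))"
  unfolding psd_seq_def
proof (intro allI)
  fix n :: nat and c :: "nat \<Rightarrow> real"
  let ?N = "\<lambda>i j. i + j + e"
  define F where "F f g = (\<Sum>i<n. \<Sum>j<n. c i * c j * (\<Sum>k\<le>?N i j. C (?N i j) k * f k * g (?N i j - k)))"
    for f g :: "nat \<Rightarrow> real"
  have 1: "0 \<le> F ((^) x) ((^) y)" if "0 \<le> x" "0 \<le> y" for x y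
    using psd[OF that] unfolding psd_seq_def F_def by blast
  have 2: "0 \<le> F s ((^) y)" if y: "0 \<le> y" for y
  proof -
    \<comment> \<open>For fixed \<open>y\<close>, this polynomial in x evaluates to the quadratic
      form \<open>F\<close>, and \<open>moment_fun s\<close> replaces each power of x by the
      corresponding moment.\<close>
    define p where "p = (\<Sum>i<n. \<Sum>j<n. \<Sum>k\<le>?N i j. monom (c i * c j * C (?N i j) k * y ^ (?N i j - k)) k)"
    have "poly p x = F ((^) x) ((^) y)" for x
      unfolding p_def F_def by (simp add: poly_sum poly_monom sum_distrib_left mult_ac)
    then have "0 \<le> moment_fun s p" using 1 y by (intro moment_fun_nonneg[OF s]) simp
    also have "moment_fun s p = F s ((^) y)"
      unfolding p_def F_def by (simp add: moment_fun_sum moment_fun_monom sum_distrib_left mult_ac)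
    finally show ?thesis .
  qed
  define p where "p = (\<Sum>i<n. \<Sum>j<n. \<Sum>k\<le>?N i j. monom (c i * c j * C (?N i j) k * s k) (?N i j - k))"
  have "poly p y = F s ((^) y)" for y
    unfolding p_def F_def by (simp add: poly_sum poly_monom sum_distrib_left mult_ac)
  then have "0 \<le> moment_fun t p" using 2 by (intro moment_fun_nonneg[OF t]) simp
  also have "moment_fun t p = F s t"
    unfolding p_def F_def by (simp add: moment_fun_sum moment_fun_monom sum_distrib_left mult_ac)
  finally show "0 \<le> (\<Sum>i<n. \<Sum>j<n. c i * c j * (\<Sum>k\<le>?N i j. C (?N i j) k * s k * t (?N i j - k)))"
    by (simp add: F_def)
qed

lemma psd_seq_J_convolution:
  assumes P: "nonneg_real.pos_params P" and s: "stieltjes_moment_seq s" and t: "stieltjes_moment_seq t"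
  defines "r \<equiv> \<lambda>n. \<Sum>k\<le>n. J_mat P n k * s k * t (n - k)"
  shows "psd_seq r" "psd_seq (\<lambda>n. r (Suc n))"
proof -
  have tp: "nonneg_real.tp (\<lambda>i j. \<Sum>k\<le>i + j. J_mat P (i + j) k * x ^ k * y ^ (i + j - k))"
    if "0 \<le> x" "0 \<le> y" for x y
    using nonneg_real.hankel_tp_J_row[OF nonneg_real.pos_params_scale_params[OF P that(2)] that(1)]
    by (simp only: J_row_scale_params)
  note * = psd_seq_if_hankel_tp[OF tp]
  show "psd_seq r"
    using psd_seq_convolution[OF s t, where C = "J_mat P" and e = 0] *(1) by (simp add: r_def)
  show "psd_seq (\<lambda>n. r (Suc n))"
    using psd_seq_convolution[OF s t, where C = "J_mat P" and e = 1] *(2) by (simp add: r_def)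
qed

subsection \<open>Real polynomials with simple real roots\<close>

lemma complex_eval_pCons:
  "poly (map_poly complex_of_real (pCons a p)) z = of_real a + z * poly (map_poly of_real p) z"
  by (simp add: map_poly_pCons)

lemma complex_eval_add:
  "poly (map_poly complex_of_real (p + q)) z = poly (map_poly of_real p) z + poly (map_poly of_real q) z"
  by (induction p q rule: poly_induct2) (simp_all add: complex_eval_pCons algebra_simps)

lemma complex_eval_smult:
  "poly (map_poly complex_of_real (Polynomial.smult a p)) z = of_real a * poly (map_poly of_real p) z"
  by (induction p) (simp_all add: complex_eval_pCons algebra_simps)

lemma complex_eval_mult:
  "poly (map_poly complex_of_real (p * q)) z = poly (map_poly of_real p) z * poly (map_poly of_real q) z"
  by (induction p) (simp_all add: complex_eval_pCons complex_eval_add complex_eval_smult algebra_simps)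

lemma complex_eval_of_real: "poly (map_poly complex_of_real p) (of_real t) = of_real (poly p t)"
  by (induction p) (simp_all add: complex_eval_pCons)

text \<open>Take a complex root with real part \<open>a\<close> and imaginary part \<open>b\<close>.
  If \<open>b \<noteq> 0\<close>, the remainder modulo the quadratic is at most linear, has real
  coefficients and vanishes at a nonreal point, so it is 0.\<close>

lemma real_poly_factor_cases:
  fixes p :: "real poly"
  assumes "0 < degree p"
  obtains t where "[:- t, 1:] dvd p" | a b where "b \<noteq> 0" "[:a\<^sup>2 + b\<^sup>2, - 2 * a, 1:] dvd p"
proof -
  let ?P = "map_poly complex_of_real p"
  have "degree ?P = degree p"
    by (rule degree_map_poly) (use assms in auto)
  then have "\<not> constant (poly ?P)" using assms by (simp add: constant_degree)
  then obtain z where z: "poly ?P z = 0" using fundamental_theorem_of_algebra by blast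
  show ?thesis
  proof (cases "Im z = 0")
    case True
    then have "z = of_real (Re z)" by (simp add: complex_eq_iff)
    then have "poly p (Re z) = 0" using z by (metis complex_eval_of_real of_real_eq_0_iff)
    then show ?thesis using that(1) by (simp add: poly_eq_0_iff_dvd)
  next
    case False
    define a b where "a = Re z" and "b = Im z"
    define q where "q = [:a\<^sup>2 + b\<^sup>2, - 2 * a, 1:]"
    have qz: "poly (map_poly complex_of_real q) z = 0"
      by (simp add: q_def map_poly_pCons a_def b_def complex_eq_iff power2_eq_square algebra_simps)
    have q0: "q \<noteq> 0" and dq: "degree q = 2" by (simp_all add: q_def)
    define r where "r = p mod q"
    have "p = q * (p div q) + r" by (simp add: r_def)
    then have rz: "poly (map_poly complex_of_real r) z = 0"
      using z qz complex_eval_add complex_eval_mult by (metis add_0 mult_zero_left)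
    have "r = 0 \<or> degree r < 2" using degree_mod_less[OF q0, of p] by (auto simp: r_def dq)
    then have "r = [:coeff r 0, coeff r 1:]"
      by (auto intro!: poly_eqI simp: coeff_pCons coeff_eq_0 split: nat.splits)
    then obtain c d where r: "r = [:c, d:]" by blast
    have "of_real c + z * of_real d = 0" using rz by (simp add: r map_poly_pCons)
    then have "d = 0" "c = 0" using False by (auto simp: complex_eq_iff)
    then have "q dvd p" using r by (simp add: r_def dvd_eq_mod_eq_0)
    then show ?thesis using that(2)[of b a] False by (simp add: q_def b_def)
  qed
qed

text \<open>Without quadratic factors there is always a linear factor to peel off; without squared
  factors the roots are distinct, so a set can index them.\<close>

lemma real_poly_splits:
  fixes p :: "real poly"
  assumes "p \<noteq> 0" and "\<And>t. \<not> [:- t, 1:] * [:- t, 1:] dvd p"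
    and "\<And>a b. b \<noteq> 0 \<Longrightarrow> \<not> [:a\<^sup>2 + b\<^sup>2, - 2 * a, 1:] dvd p"
  obtains T where "finite T" "p = Polynomial.smult (lead_coeff p) (\<Prod>t\<in>T. [:- t, 1:])"
proof -
  have "\<exists>T. finite T \<and> p = Polynomial.smult (lead_coeff p) (\<Prod>t\<in>T. [:- t, 1:])"
    using assms
  proof (induction "degree p" arbitrary: p)
    case 0
    obtain a where "p = [:a:]" by (rule degree_eq_zeroE[OF 0(1)[symmetric]])
    then show ?case by (intro exI[of _ "{}"]) simp
  next
    case (Suc n)
    obtain t where "[:- t, 1:] dvd p"
      using Suc.hyps(2) Suc.prems(3) by (metis real_poly_factor_cases zero_less_Suc)
    then obtain g where p: "p = [:- t, 1:] * g" by (elim dvdE)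
    have g0: "g \<noteq> 0" using Suc.prems(1) p by auto
    have "degree p = Suc (degree g)"
      unfolding p using g0 by (subst degree_mult_eq) auto
    then have dg: "n = degree g" using Suc.hyps(2) by simp
    have "\<exists>T. finite T \<and> g = Polynomial.smult (lead_coeff g) (\<Prod>t\<in>T. [:- t, 1:])"
    proof (rule Suc.hyps(1)[OF dg g0])
      show "\<not> [:- t, 1:] * [:- t, 1:] dvd g" for t
        using Suc.prems(2)[of t] p by (metis dvd_mult)
      show "\<not> [:a\<^sup>2 + b\<^sup>2, - 2 * a, 1:] dvd g" if "b \<noteq> 0" for a b
        using Suc.prems(3)[OF that, of a] p by (metis dvd_mult)
    qed
    then obtain T where T: "finite T" "g = Polynomial.smult (lead_coeff g) (\<Prod>t\<in>T. [:- t, 1:])" by blast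
    have "t \<notin> T"
    proof
      assume "t \<in> T"
      then have "[:- t, 1:] dvd (\<Prod>t\<in>T. [:- t, 1:])" using T(1) by (metis dvd_prodI)
      then have "[:- t, 1:] dvd g" using T(2) by (metis dvd_smult)
      then have "[:- t, 1:] * [:- t, 1:] dvd p" unfolding p by (rule mult_dvd_mono[OF dvd_refl])
      then show False using Suc.prems(2) by blast
    qed
    moreover have "lead_coeff p = lead_coeff g" unfolding p lead_coeff_mult by simp
    ultimately have "p = Polynomial.smult (lead_coeff p) (\<Prod>t\<in>insert t T. [:- t, 1:])"
      using T p by (metis mult_smult_right prod.insert)
    then show ?case using T(1) by blast
  qed
  then show ?thesis using that by blast
qed

lemma degree_eq_degree_div:
  fixes p f :: "'a::field poly"
  assumes "p \<noteq> 0" "f div p \<noteq> 0"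
  shows "degree f = degree p + degree (f div p)"
proof -
  have d: "degree (p * (f div p)) = degree p + degree (f div p)"
    using assms by (simp add: degree_mult_eq)
  have f: "f = p * (f div p) + f mod p" by simp
  show ?thesis
  proof (cases "f mod p = 0")
    case True
    then show ?thesis using f d by (metis add.right_neutral)
  next
    case False
    then have "degree (f mod p) < degree (p * (f div p))"
      using degree_mod_less[OF assms(1), of f] d by simp
    then show ?thesis using f d by (metis degree_add_eq_left)
  qed
qed

subsection \<open>Gauss quadrature\<close>

locale positive_moment_functional =
  fixes s :: "nat \<Rightarrow> real"
  assumes psd: "psd_seq s" and psd_shift: "psd_seq (\<lambda>n. s (Suc n))"
begin

abbreviation \<Lambda> :: "real poly \<Rightarrow> real" where "\<Lambda> \<equiv> moment_fun s"

lemmas linear = moment_fun_add moment_fun_diff moment_fun_smult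

lemma square_nonneg: "0 \<le> \<Lambda> (p * p)"
  by (rule moment_fun_square_nonneg[OF psd])

lemma X_square_nonneg: "0 \<le> \<Lambda> (pCons 0 (p * p))"
  unfolding moment_fun_pCons_0 by (rule moment_fun_square_nonneg[OF psd_shift])

text \<open>Orthogonality makes \<open>p\<close> split with simple nonnegative roots: if \<open>p = k * g\<close>, then
  \<open>\<Lambda> (k * g * g) = 0\<close>, which is impossible when \<open>k\<close> is a square, a positive definite quadratic, or
  \<open>x - t\<close> with \<open>t < 0\<close>. The weights are \<open>\<Lambda> l\<close> for the Lagrange polynomials \<open>l\<close>, and \<open>\<Lambda> l = \<Lambda> (l * l)\<close>.\<close>

lemma quadrature:
  assumes p0: "p \<noteq> 0"
    and orth: "\<And>g. degree g < degree p \<Longrightarrow> \<Lambda> (p * g) = 0"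
    and pd: "\<And>g. g \<noteq> 0 \<Longrightarrow> degree g < degree p \<Longrightarrow> 0 < \<Lambda> (g * g)"
  obtains T w where "finite T" "\<And>t. t \<in> T \<Longrightarrow> 0 \<le> t" "\<And>t. t \<in> T \<Longrightarrow> 0 \<le> w t"
    "\<And>f. \<Lambda> (p * (f div p)) = 0 \<Longrightarrow> \<Lambda> f = (\<Sum>t\<in>T. w t * poly f t)"
proof -
  have factor: "g \<noteq> 0 \<and> degree p = degree k + degree g" if "p = k * g" for k g
    using that p0 by (auto simp: degree_mult_eq)
  have "\<not> [:- t, 1:] * [:- t, 1:] dvd p" for t
  proof
    assume "[:- t, 1:] * [:- t, 1:] dvd p"
    then obtain g where p: "p = [:- t, 1:] * [:- t, 1:] * g" by (elim dvdE)
    have g: "g \<noteq> 0" "degree p = 2 + degree g" using factor[OF p] by (simp_all add: degree_mult_eq)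
    let ?h = "[:- t, 1:] * g"
    have "0 < \<Lambda> (?h * ?h)"
      using g by (intro pd) (auto simp: degree_mult_eq simp del: mult_pCons_left)
    also have "?h * ?h = p * g" unfolding p by (simp only: mult_ac)
    finally show False using orth[of g] g by simp
  qed
  moreover have "\<not> [:a\<^sup>2 + b\<^sup>2, - 2 * a, 1:] dvd p" if b: "b \<noteq> 0" for a b
  proof
    assume "[:a\<^sup>2 + b\<^sup>2, - 2 * a, 1:] dvd p"
    then obtain g where p: "p = [:a\<^sup>2 + b\<^sup>2, - 2 * a, 1:] * g" by (elim dvdE)
    have g: "g \<noteq> 0" "degree p = 2 + degree g" using factor[OF p] by simp_all
    let ?h = "[:- a, 1:] * g"
    have eq: "[:a\<^sup>2 + b\<^sup>2, - 2 * a, 1:] = [:- a, 1:] * [:- a, 1:] + [:b\<^sup>2:]"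
      by (simp add: power2_eq_square)
    have "p * g = ?h * ?h + [:b\<^sup>2:] * (g * g)"
      unfolding p eq by (simp only: distrib_left distrib_right mult_ac)
    then have "p * g = ?h * ?h + Polynomial.smult (b\<^sup>2) (g * g)" by simp
    then have "\<Lambda> (p * g) = \<Lambda> (?h * ?h) + b\<^sup>2 * \<Lambda> (g * g)" by (simp only: linear)
    moreover have "0 < \<Lambda> (g * g)" using g by (intro pd) auto
    moreover have "0 \<le> \<Lambda> (?h * ?h)" by (rule square_nonneg)
    moreover have "0 < b\<^sup>2" using b by simp
    ultimately have "0 < \<Lambda> (p * g)" by (metis add_nonneg_pos mult_pos_pos)
    then show False using orth[of g] g by simp
  qed
  ultimately obtain T where T: "finite T" and pT: "p = Polynomial.smult (lead_coeff p) (\<Prod>t\<in>T. [:- t, 1:])"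
    using real_poly_splits[OF p0] by metis
  have root: "poly p t = 0" if "t \<in> T" for t
    using that T by (subst pT) (auto simp: poly_prod prod_zero_iff)
  have card: "degree p = card T"
    using p0 by (subst pT) (simp add: degree_prod_eq_sum_degree)
  have Tpos: "0 \<le> t" if t: "t \<in> T" for t
  proof -
    obtain g where p: "p = [:- t, 1:] * g" using root[OF t] by (auto simp: poly_eq_0_iff_dvd)
    have g: "g \<noteq> 0" "degree p = 1 + degree g" using factor[OF p] by simp_all
    have "p * g = pCons 0 (g * g) - Polynomial.smult t (g * g)"
      unfolding p by (simp add: algebra_simps)
    then have "\<Lambda> (p * g) = \<Lambda> (pCons 0 (g * g)) - t * \<Lambda> (g * g)" by (simp only: linear)
    moreover have "\<Lambda> (p * g) = 0" using g by (intro orth) simp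
    moreover have "0 < \<Lambda> (g * g)" using g by (intro pd) auto
    moreover have "0 \<le> \<Lambda> (pCons 0 (g * g))" by (rule X_square_nonneg)
    ultimately show ?thesis by (simp add: zero_le_mult_iff)
  qed
  define l where "l t = (\<Prod>u\<in>T - {t}. Polynomial.smult (1 / (t - u)) [:- u, 1:])" for t
  have l_same: "poly (l t) t = 1" if "t \<in> T" for t
    unfolding l_def poly_prod by (intro prod.neutral) (auto simp: diff_divide_distrib[symmetric])
  have l_diff: "poly (l t) u = 0" if "u \<in> T" "u \<noteq> t" for t u
    unfolding l_def poly_prod using that T by (intro prod_zero) auto
  have l_degree: "degree (l t) < card T" if "t \<in> T" for t
  proof -
    have "degree (l t) \<le> (\<Sum>u\<in>T - {t}. degree (Polynomial.smult (1 / (t - u)) [:- u, 1:]))"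
      unfolding l_def by (rule order.trans[OF degree_prod_sum_le]) (use T in \<open>simp_all add: o_def\<close>)
    also have "\<dots> \<le> (\<Sum>u\<in>T - {t}. 1)"
      by (intro sum_mono order.trans[OF degree_smult_le]) simp
    also have "\<dots> < card T" using card_Diff1_less[OF T that] by simp
    finally show ?thesis .
  qed
  define w where "w t = \<Lambda> (l t)" for t
  \<comment> \<open>The remainder is recovered by Lagrange interpolation at the roots. Asking for a
    vanishing quotient part, and not for a degree bound, fits both the degenerate and the regular
    case of \<open>truncated_moments\<close>.\<close>
  have quad: "\<Lambda> f = (\<Sum>t\<in>T. w t * poly f t)" if f: "\<Lambda> (p * (f div p)) = 0" for f
  proof -
    have "f mod p = (\<Sum>t\<in>T. Polynomial.smult (poly f t) (l t))"
    proof (cases "T = {}")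
      case True
      then have "degree p = 0" using card by simp
      then obtain a where "p = [:a:]" by (rule degree_eq_zeroE)
      then have "p dvd f" using p0 by (simp add: const_poly_dvd_iff dvd_field_iff)
      then show ?thesis using True by simp
    next
      case False
      then have cT: "0 < card T" using T by (simp add: card_gt_0_iff)
      show ?thesis
      proof (rule poly_eqI_degree[of T])
        fix t assume t: "t \<in> T"
        have "poly f t = poly (p * (f div p) + f mod p) t" by simp
        then have "poly (f mod p) t = poly f t"
          using root[OF t] by (simp only: poly_add poly_mult mult_zero_left add_0)
        also have "\<dots> = (\<Sum>u\<in>{t}. poly f u * poly (l u) t)"
          using l_same[OF t] by simp
        also have "\<dots> = (\<Sum>u\<in>T. poly f u * poly (l u) t)"
          using t T l_diff by (intro sum.mono_neutral_left) auto
        finally show "poly (f mod p) t = poly (\<Sum>t\<in>T. Polynomial.smult (poly f t) (l t)) t"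
          by (simp add: poly_sum)
      next
        show "degree (f mod p) < card T"
          using degree_mod_less[OF p0, of f] cT card by auto
        show "degree (\<Sum>t\<in>T. Polynomial.smult (poly f t) (l t)) < card T"
          using l_degree cT by (intro degree_sum_less) (auto intro: le_less_trans[OF degree_smult_le])
      qed
    qed
    moreover have "f = p * (f div p) + f mod p" by simp
    then have "\<Lambda> f = \<Lambda> (p * (f div p)) + \<Lambda> (f mod p)" by (metis moment_fun_add)
    ultimately show ?thesis
      using f by (simp add: moment_fun_sum linear w_def mult_ac)
  qed
  have "0 \<le> w t" if t: "t \<in> T" for t
  proof -
    have "\<Lambda> (p * ((l t * l t) div p)) = 0"
    proof (cases "degree ((l t * l t) div p) < degree p")
      case False
      have lt: "degree (l t * l t) < degree p + degree p"
        using l_degree[OF t] card degree_mult_le[of "l t" "l t"] by linarith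
      have "(l t * l t) div p = 0"
      proof (rule ccontr)
        assume nz: "(l t * l t) div p \<noteq> 0"
        have "degree (l t * l t) = degree p + degree ((l t * l t) div p)"
          by (rule degree_eq_degree_div[OF p0 nz])
        then show False using lt False by simp
      qed
      then show ?thesis by simp
    qed (rule orth)
    then have "\<Lambda> (l t * l t) = (\<Sum>u\<in>T. w u * poly (l t * l t) u)" by (rule quad)
    also have "\<dots> = (\<Sum>u\<in>{t}. w u * poly (l t * l t) u)"
      using t T l_diff by (intro sum.mono_neutral_right) auto
    also have "\<dots> = w t" by (simp add: l_same[OF t])
    finally show ?thesis using square_nonneg[of "l t"] by simp
  qed
  then show ?thesis using that T Tpos quad by blast
qed

text \<open>A Gram-Schmidt step: the projection of \<open>f\<close> is corrected by a multiple of
  \<open>e\<close>, the monomial of degree \<open>m\<close> made orthogonal to lower degrees. The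
  subspace is given by vanishing coefficients because no polynomial, not even 0, has degree below
  0.\<close>

lemma orthogonal_projection:
  assumes "\<And>g. g \<noteq> 0 \<Longrightarrow> degree g < m \<Longrightarrow> 0 < \<Lambda> (g * g)"
  shows "\<exists>g. (\<forall>i\<ge>m. coeff g i = 0) \<and> (\<forall>h. (\<forall>i\<ge>m. coeff h i = 0) \<longrightarrow> \<Lambda> ((f - g) * h) = 0)"
  using assms
proof (induction m arbitrary: f)
  case 0
  show ?case
  proof (intro exI[of _ 0] conjI allI impI)
    fix h :: "real poly" assume "\<forall>i\<ge>0. coeff h i = 0"
    then have "h = 0" by (simp add: poly_eq_iff)
    then show "\<Lambda> ((f - 0) * h) = 0" by simp
  qed simp
next
  case (Suc m)
  have IH: "\<exists>g. (\<forall>i\<ge>m. coeff g i = 0) \<and> (\<forall>h. (\<forall>i\<ge>m. coeff h i = 0) \<longrightarrow> \<Lambda> ((f - g) * h) = 0)" for f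
    by (rule Suc.IH) (use Suc.prems in auto)
  obtain g where g: "\<And>i. i \<ge> m \<Longrightarrow> coeff g i = 0"
    and g_orth: "\<And>h. (\<And>i. i \<ge> m \<Longrightarrow> coeff h i = 0) \<Longrightarrow> \<Lambda> ((monom 1 m - g) * h) = 0"
    using IH[of "monom 1 m"] by blast
  define e where "e = monom 1 m - g"
  have em: "coeff e m = 1" and e_high: "\<And>i. i > m \<Longrightarrow> coeff e i = 0"
    using g by (auto simp: e_def)
  have "e \<noteq> 0" using em by auto
  moreover have "degree e < Suc m"
    using e_high by (simp add: less_Suc_eq_le degree_le)
  ultimately have ee: "0 < \<Lambda> (e * e)" by (rule Suc.prems)
  obtain f1 where f1: "\<And>i. i \<ge> m \<Longrightarrow> coeff f1 i = 0"
    and f1_orth: "\<And>h. (\<And>i. i \<ge> m \<Longrightarrow> coeff h i = 0) \<Longrightarrow> \<Lambda> ((f - f1) * h) = 0"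
    using IH[of f] by blast
  define c where "c = \<Lambda> ((f - f1) * e) / \<Lambda> (e * e)"
  show ?case
  proof (intro exI[of _ "f1 + Polynomial.smult c e"] conjI allI impI)
    fix i assume "Suc m \<le> i"
    then show "coeff (f1 + Polynomial.smult c e) i = 0" using f1 e_high by simp
  next
    fix h :: "real poly" assume h: "\<forall>i\<ge>Suc m. coeff h i = 0"
    define a where "a = coeff h m"
    define k where "k = h - Polynomial.smult a e"
    have k: "coeff k i = 0" if "i \<ge> m" for i
      using that h em e_high by (cases "i = m") (auto simp: k_def a_def)
    have hk: "h = Polynomial.smult a e + k" by (simp add: k_def)
    have "(f - (f1 + Polynomial.smult c e)) * h =
      Polynomial.smult a ((f - f1) * e) + (f - f1) * k
      - (Polynomial.smult (c * a) (e * e) + Polynomial.smult c (e * k))"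
      unfolding hk by (simp add: algebra_simps smult_diff_right smult_add_right)
    then have "\<Lambda> ((f - (f1 + Polynomial.smult c e)) * h) = a * \<Lambda> ((f - f1) * e) - c * a * \<Lambda> (e * e)"
      using f1_orth[OF k] g_orth[OF k] by (simp add: linear e_def)
    also have "\<dots> = 0" using ee by (simp add: c_def)
    finally show "\<Lambda> ((f - (f1 + Polynomial.smult c e)) * h) = 0" .
  qed
qed

text \<open>If some nonzero \<open>g\<close> of degree below \<open>N\<close> has
  \<open>\<Lambda> (g * g) = 0\<close>, the nodes are the roots of such a polynomial of least
  degree. Otherwise they are the roots of the monic orthogonal polynomial of degree
  \<open>N\<close>; dividing \<open>x^n\<close> with \<open>n < 2 * N\<close> by it leaves a
  quotient of degree below \<open>N\<close>.\<close>

lemma truncated_moments: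
  obtains T w where "finite T" "\<And>t. t \<in> T \<Longrightarrow> 0 \<le> t" "\<And>t. t \<in> T \<Longrightarrow> 0 \<le> w t"
    "\<And>n. n < 2 * N \<Longrightarrow> s n = (\<Sum>t\<in>T. w t * t ^ n)"
proof -
  note result = that
  have *: thesis
    if p: "p \<noteq> 0" "\<And>g. degree g < degree p \<Longrightarrow> \<Lambda> (p * g) = 0"
      "\<And>g. g \<noteq> 0 \<Longrightarrow> degree g < degree p \<Longrightarrow> 0 < \<Lambda> (g * g)"
      and div: "\<And>n. n < 2 * N \<Longrightarrow> \<Lambda> (p * (monom 1 n div p)) = 0" for p
  proof -
    obtain T w where Tw: "finite T" "\<And>t. t \<in> T \<Longrightarrow> 0 \<le> t" "\<And>t. t \<in> T \<Longrightarrow> 0 \<le> w t"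
      "\<And>f. \<Lambda> (p * (f div p)) = 0 \<Longrightarrow> \<Lambda> f = (\<Sum>t\<in>T. w t * poly f t)"
      using quadrature[OF p] by metis
    have "s n = (\<Sum>t\<in>T. w t * t ^ n)" if "n < 2 * N" for n
      using Tw(4)[OF div[OF that]] by (simp add: moment_fun_monom poly_monom)
    then show thesis using result Tw(1-3) by blast
  qed
  show thesis
  proof (cases "\<exists>g. g \<noteq> 0 \<and> degree g < N \<and> \<Lambda> (g * g) = 0")
    case True
    define P where "P g \<longleftrightarrow> g \<noteq> 0 \<and> \<Lambda> (g * g) = 0" for g
    have "\<exists>p. P p \<and> (\<forall>g. P g \<longrightarrow> degree p \<le> degree g)"
      using True ex_has_least_nat[of P _ degree] by (auto simp: P_def)
    then obtain p where p: "p \<noteq> 0" "\<Lambda> (p * p) = 0"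
      and min: "\<And>g. g \<noteq> 0 \<Longrightarrow> \<Lambda> (g * g) = 0 \<Longrightarrow> degree p \<le> degree g"
      by (auto simp: P_def)
    have orth: "\<Lambda> (p * g) = 0" for g
    proof (rule ccontr)
      assume nz: "\<Lambda> (p * g) \<noteq> 0"
      \<comment> \<open>As \<open>\<Lambda> (p * p) = 0\<close>, the value of
        \<open>\<Lambda>\<close> at the square of \<open>c p + g\<close> is affine in
        \<open>c\<close>; this \<open>c\<close> makes it -1.\<close>
      define c where "c = - (\<Lambda> (g * g) + 1) / (2 * \<Lambda> (p * g))"
      have "0 \<le> \<Lambda> ((Polynomial.smult c p + g) * (Polynomial.smult c p + g))" by (rule square_nonneg)
      also have "(Polynomial.smult c p + g) * (Polynomial.smult c p + g) =
          Polynomial.smult (c * c) (p * p)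
          + (Polynomial.smult c (p * g) + Polynomial.smult c (p * g)) + g * g"
        by (simp only: distrib_left distrib_right mult_smult_left mult_smult_right smult_smult
            add_ac mult.commute)
      also have "\<Lambda> \<dots> = 2 * c * \<Lambda> (p * g) + \<Lambda> (g * g)" by (simp only: linear p(2))
      also have "\<dots> = - 1" using nz by (simp add: c_def field_simps)
      finally show False by simp
    qed
    show thesis
    proof (rule *[of p])
      fix g :: "real poly" assume "g \<noteq> 0" "degree g < degree p"
      then show "0 < \<Lambda> (g * g)" using min[of g] square_nonneg[of g] by force
    qed (use p orth in auto)
  next
    case False
    then have pd: "0 < \<Lambda> (g * g)" if "g \<noteq> 0" "degree g < N" for g
      using that square_nonneg[of g] by force
    obtain g where g: "\<And>i. i \<ge> N \<Longrightarrow> coeff g i = 0"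
      and g_orth: "\<And>h. (\<And>i. i \<ge> N \<Longrightarrow> coeff h i = 0) \<Longrightarrow> \<Lambda> ((monom 1 N - g) * h) = 0"
      using orthogonal_projection[OF pd, of N "monom 1 N"] by blast
    define p where "p = monom 1 N - g"
    have cN: "coeff p N = 1" and high: "\<And>i. i > N \<Longrightarrow> coeff p i = 0"
      using g by (auto simp: p_def)
    have dp: "degree p = N"
      using cN high by (intro antisym degree_le le_degree) auto
    have p0: "p \<noteq> 0" using cN by auto
    have orth: "\<Lambda> (p * h) = 0" if "degree h < N" for h
      unfolding p_def by (rule g_orth) (use that in \<open>auto intro: coeff_eq_0\<close>)
    show thesis
    proof (rule *[OF p0])
      fix n assume n: "n < 2 * N"
      show "\<Lambda> (p * (monom 1 n div p)) = 0"
      proof (cases "monom 1 n div p = 0")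
        case nz: False
        have "degree (monom (1::real) n) = degree p + degree (monom 1 n div p)"
          by (rule degree_eq_degree_div[OF p0 nz])
        then have "degree (monom 1 n div p) < N" using n dp by (simp add: degree_monom_eq)
        then show ?thesis by (rule orth)
      qed simp
    qed (use orth pd dp in auto)
  qed
qed

end

subsection \<open>The Stieltjes moment problem\<close>

text \<open>The \<open>distr\<close> along the identity carries the measure from the power set of
  \<open>T\<close> to the Borel sets of the line, as a \<open>real_distribution\<close>
  demands.\<close>

lemma has_bochner_integral_point_measure_distr:
  fixes g :: "real \<Rightarrow> real"
  assumes T: "finite T" and w: "\<And>t. t \<in> T \<Longrightarrow> 0 \<le> w t" and g: "g \<in> borel_measurable borel"
  shows "has_bochner_integral (distr (point_measure T w) borel (\<lambda>x. x)) g (\<Sum>t\<in>T. w t * g t)"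
proof -
  have m: "(\<lambda>x. x) \<in> point_measure T w \<rightarrow>\<^sub>M borel" by (auto simp: measurable_def space_point_measure sets_point_measure)
  have "integrable (point_measure T w) g" by (rule integrable_point_measure_finite[OF T])
  moreover have "integral\<^sup>L (point_measure T w) g = (\<Sum>t\<in>T. w t * g t)"
    using lebesgue_integral_point_measure_finite[OF T, of w g] w by (simp add: mult.commute)
  ultimately show ?thesis
    using g m by (simp add: has_bochner_integral_iff integrable_distr_eq integral_distr)
qed

lemma real_distribution_point_measure_distr:
  fixes T :: "real set"
  assumes T: "finite T" and w: "\<And>t. t \<in> T \<Longrightarrow> 0 \<le> w t" and one: "(\<Sum>t\<in>T. w t) = 1"
  shows "real_distribution (distr (point_measure T (\<lambda>t. ennreal (w t))) borel (\<lambda>x. x))"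
proof -
  have "emeasure (point_measure T (\<lambda>t. ennreal (w t))) T = 1"
    using emeasure_point_measure_finite[OF T, of T "\<lambda>t. ennreal (w t)"] w one
    by (simp add: sum_ennreal[symmetric])
  then interpret prob_space "point_measure T (\<lambda>t. ennreal (w t))"
    by (intro prob_spaceI) (simp add: space_point_measure)
  show ?thesis
    by (rule real_distribution_distr) (auto simp: measurable_def space_point_measure sets_point_measure)
qed

context positive_moment_functional
begin

lemma moment_nonneg: "0 \<le> s n"
proof -
  obtain T w where "finite T" "\<And>t. t \<in> T \<Longrightarrow> 0 \<le> t" "\<And>t. t \<in> T \<Longrightarrow> 0 \<le> w t"
    "\<And>k. k < 2 * Suc n \<Longrightarrow> s k = (\<Sum>t\<in>T. w t * t ^ k)"
    using truncated_moments[of "Suc n"] by metis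
  then show ?thesis by (auto intro!: sum_nonneg)
qed

lemma zero_if_first_zero:
  assumes "s 0 = 0"
  shows "s n = 0"
proof -
  obtain T w where T: "finite T" "\<And>t. t \<in> T \<Longrightarrow> 0 \<le> w t"
    and s: "\<And>k. k < 2 * Suc n \<Longrightarrow> s k = (\<Sum>t\<in>T. w t * t ^ k)"
    using truncated_moments[of "Suc n"] by metis
  have "(\<Sum>t\<in>T. w t) = 0" using s[of 0] assms by simp
  then have "w t = 0" if "t \<in> T" for t using T that by (simp add: sum_nonneg_eq_0_iff)
  then show ?thesis using s[of n] by simp
qed

text \<open>Quadrature measures matching more and more moments are tight, so a subsequence converges
  weakly. Powers are unbounded, hence moments reach the limit through the truncations
  \<open>min (max x 0) k\<close>, whose powers are bounded, continuous and increasing in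
  \<open>k\<close>.\<close>

lemma stieltjes_normalised:
  assumes s0: "s 0 = 1"
  obtains M where "real_distribution M" "AE x in M. 0 \<le> x"
    "\<And>n. has_bochner_integral M (\<lambda>x. (max x 0) ^ n) (s n)"
proof -
  have "\<exists>T w. finite T \<and> (\<forall>t\<in>T. 0 \<le> t \<and> 0 \<le> w t) \<and>
      (\<forall>n < 2 * Suc N. s n = (\<Sum>t\<in>T. w t * t ^ n))" for N
    using truncated_moments[of "Suc N"] by metis
  then obtain T w where T: "\<And>N. finite (T N)" and nonneg: "\<And>N t. t \<in> T N \<Longrightarrow> 0 \<le> t \<and> 0 \<le> w N t"
    and mom: "\<And>N n. n < 2 * Suc N \<Longrightarrow> s n = (\<Sum>t\<in>T N. w N t * t ^ n)"
    by metis
  define \<mu> where "\<mu> N = distr (point_measure (T N) (\<lambda>t. ennreal (w N t))) borel (\<lambda>x. x)" for N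
  have one: "(\<Sum>t\<in>T N. w N t) = 1" for N using mom[of 0 N] s0 by simp
  have \<mu>: "real_distribution (\<mu> N)" for N
    unfolding \<mu>_def using T nonneg one by (intro real_distribution_point_measure_distr) auto
  have int_\<mu>: "integral\<^sup>L (\<mu> N) g = (\<Sum>t\<in>T N. w N t * g t)"
    if "g \<in> borel_measurable borel" for g :: "real \<Rightarrow> real" and N
    unfolding \<mu>_def using T nonneg that
    by (intro has_bochner_integral_integral_eq has_bochner_integral_point_measure_distr) auto
  have "tight \<mu>"
    unfolding tight_def
  proof (intro conjI allI impI \<mu>)
    fix \<epsilon> :: real assume \<epsilon>: "0 < \<epsilon>"
    \<comment> \<open>By Markov's inequality the mass above \<open>K\<close> is at most
      \<open>s 1 / K < \<epsilon>\<close>. The left end -1 lets the half-open interval contain a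
      possible node at 0.\<close>
    define K where "K = s 1 / \<epsilon> + 1"
    have K: "0 < K" using moment_nonneg[of 1] \<epsilon> by (simp add: K_def add_nonneg_pos)
    have "s 1 / K < \<epsilon>" using K \<epsilon> by (simp add: K_def field_simps)
    have "1 - \<epsilon> < measure (\<mu> N) {- 1<..K}" for N
    proof -
      interpret real_distribution "\<mu> N" by (rule \<mu>)
      have "measure (\<mu> N) {- 1<..K} = integral\<^sup>L (\<mu> N) (indicator {- 1<..K})" by simp
      also have "\<dots> = (\<Sum>t\<in>T N. w N t * indicator {- 1<..K} t)" by (rule int_\<mu>) simp
      also have "\<dots> \<ge> (\<Sum>t\<in>T N. w N t * (1 - t / K))"
      proof (rule sum_mono)
        fix t assume t: "t \<in> T N"
        have "1 - t / K \<le> indicator {- 1<..K} t"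
          using nonneg[OF t] K by (auto simp: indicator_def field_simps)
        then show "w N t * (1 - t / K) \<le> w N t * indicator {- 1<..K} t"
          using nonneg[OF t] by (intro mult_left_mono) auto
      qed
      also have "(\<Sum>t\<in>T N. w N t * (1 - t / K)) = 1 - s 1 / K"
        using one[of N] mom[of 1 N]
        by (simp add: right_diff_distrib sum_subtractf sum_divide_distrib)
      finally show ?thesis using \<open>s 1 / K < \<epsilon>\<close> by simp
    qed
    then show "\<exists>a b. a < b \<and> (\<forall>n. 1 - \<epsilon> < measure (\<mu> n) {a<..b})"
      using K by (intro exI[of _ "- 1"] exI[of _ K]) auto
  qed
  then obtain r M where r: "strict_mono r" and M: "real_distribution M"
    and weak: "weak_conv_m (\<lambda>N. \<mu> (r N)) M"
    using tight_imp_convergent_subsubsequence[of \<mu> id] by (auto simp: strict_mono_def o_def)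
  interpret M: real_distribution M by (rule M)
  have conv: "(\<lambda>N. \<Sum>t\<in>T (r N). w (r N) t * f t) \<longlonglongrightarrow> integral\<^sup>L M f"
    if "\<And>x. isCont f x" "\<And>x. norm (f x) \<le> B" for f :: "real \<Rightarrow> real" and B
  proof -
    have "f \<in> borel_measurable borel"
      using that(1) by (intro borel_measurable_continuous_onI continuous_at_imp_continuous_on) auto
    moreover have "(\<lambda>N. integral\<^sup>L (\<mu> (r N)) f) \<longlonglongrightarrow> integral\<^sup>L M f"
      using \<mu> M weak that by (intro weak_conv_imp_integral_bdd_continuous_conv[where B = B]) auto
    ultimately show ?thesis by (simp add: int_\<mu>)
  qed
  have "AE x in M. 0 \<le> x"
  proof -
    \<comment> \<open>A bounded continuous test function that vanishes exactly on the nonnegative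
      half-line.\<close>
    let ?f = "\<lambda>x :: real. min 1 (max 0 (- x))"
    have "(\<lambda>N. \<Sum>t\<in>T (r N). w (r N) t * ?f t) \<longlonglongrightarrow> integral\<^sup>L M ?f"
      by (rule conv[of _ 1]) (auto intro!: continuous_intros)
    moreover have "(\<Sum>t\<in>T N. w N t * ?f t) = 0" for N
      using nonneg by (intro sum.neutral) auto
    ultimately have "integral\<^sup>L M ?f = 0" by (simp add: LIMSEQ_const_iff)
    moreover have "integrable M ?f" by (rule M.integrable_const_bound[of _ 1]) auto
    ultimately have "AE x in M. ?f x = 0"
      by (subst (asm) integral_nonneg_eq_0_iff_AE) auto
    then show ?thesis by (rule AE_mp) (auto simp: min_def max_def split: if_splits)
  qed
  moreover have "has_bochner_integral M (\<lambda>x. (max x 0) ^ n) (s n)" for n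
  proof (rule has_bochner_integral_monotone_convergence)
    let ?f = "\<lambda>k x. (min (max x 0) (real k)) ^ n"
    have bound: "norm (?f k x) \<le> real k ^ n" for k x
      by (auto simp: power_mono)
    show "integrable M (?f k)" for k
      by (rule M.integrable_const_bound[of _ "real k ^ n"]) (use bound in auto)
    show "AE x in M. mono (\<lambda>k. ?f k x)"
      by (intro AE_I2 monoI power_mono) auto
    show "AE x in M. (\<lambda>k. ?f k x) \<longlonglongrightarrow> (max x 0) ^ n"
    proof (intro AE_I2 tendsto_eventually)
      fix x :: real
      show "\<forall>\<^sub>F k in sequentially. ?f k x = (max x 0) ^ n"
        using eventually_ge_at_top[of "nat \<lceil>max x 0\<rceil>"]
        by eventually_elim (simp add: min_absorb1 nat_le_iff ceiling_le_iff)
    qed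
    \<comment> \<open>Truncation errs only where \<open>t > k\<close>, and there
      \<open>t ^ n \<le> t ^ Suc n / k\<close>. So the next moment bounds the error uniformly along
      the subsequence, once both moments are matched.\<close>
    have step: "integral\<^sup>L M (?f k) \<le> s n \<and> s n - s (Suc n) / real k \<le> integral\<^sup>L M (?f k)"
      if k: "0 < k" for k
    proof -
      have lim: "(\<lambda>N. \<Sum>t\<in>T (r N). w (r N) t * ?f k t) \<longlonglongrightarrow> integral\<^sup>L M (?f k)"
        by (rule conv[OF _ bound]) (auto intro!: continuous_intros)
      have rN: "N \<le> r N" for N by (rule seq_suble[OF r])
      have "(\<Sum>t\<in>T (r N). w (r N) t * ?f k t) \<le> s n \<and>
          s n - s (Suc n) / real k \<le> (\<Sum>t\<in>T (r N). w (r N) t * ?f k t)" if "n \<le> N" for N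
      proof -
        have N: "n < 2 * Suc (r N)" "Suc n < 2 * Suc (r N)" using that rN[of N] by simp_all
        have "(\<Sum>t\<in>T (r N). w (r N) t * ?f k t) \<le> (\<Sum>t\<in>T (r N). w (r N) t * t ^ n)"
          using nonneg by (intro sum_mono mult_left_mono power_mono) auto
        moreover have "(\<Sum>t\<in>T (r N). w (r N) t * (t ^ n - t ^ Suc n / real k)) \<le>
            (\<Sum>t\<in>T (r N). w (r N) t * ?f k t)"
        proof (intro sum_mono mult_left_mono)
          fix t assume t: "t \<in> T (r N)"
          show "t ^ n - t ^ Suc n / real k \<le> ?f k t"
          proof (cases "t \<le> real k")
            case True
            then show ?thesis using nonneg[OF t] k by simp
          next
            case False
            then have "t ^ n * 1 \<le> t ^ n * (t / real k)"
              using k nonneg[OF t] by (intro mult_left_mono) (auto simp: field_simps)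
            then have "t ^ n - t ^ Suc n / real k \<le> 0" by (simp add: mult_ac)
            also have "0 \<le> ?f k t" by simp
            finally show ?thesis .
          qed
        qed (use nonneg in auto)
        moreover have "(\<Sum>t\<in>T (r N). w (r N) t * (t ^ n - t ^ Suc n / real k)) = s n - s (Suc n) / real k"
          unfolding mom[OF N(1)] mom[OF N(2)]
          by (simp add: right_diff_distrib sum_subtractf sum_divide_distrib)
        ultimately show ?thesis by (simp add: mom[OF N(1)])
      qed
      then have "\<forall>\<^sub>F N in sequentially. (\<Sum>t\<in>T (r N). w (r N) t * ?f k t) \<le> s n"
        "\<forall>\<^sub>F N in sequentially. s n - s (Suc n) / real k \<le> (\<Sum>t\<in>T (r N). w (r N) t * ?f k t)"
        by (auto simp: eventually_sequentially)
      then show ?thesis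
        using tendsto_upperbound[OF lim] tendsto_lowerbound[OF lim] by auto
    qed
    show "(\<lambda>k. integral\<^sup>L M (?f k)) \<longlonglongrightarrow> s n"
    proof (rule tendsto_sandwich)
      show "\<forall>\<^sub>F k in sequentially. s n - s (Suc n) / real k \<le> integral\<^sup>L M (?f k)"
        "\<forall>\<^sub>F k in sequentially. integral\<^sup>L M (?f k) \<le> s n"
        using eventually_gt_at_top[of 0] by (eventually_elim, use step in blast)+
      have "(\<lambda>k. s n - s (Suc n) / real k) \<longlonglongrightarrow> s n - 0"
        by (intro tendsto_diff tendsto_const lim_const_over_n)
      then show "(\<lambda>k. s n - s (Suc n) / real k) \<longlonglongrightarrow> s n" by simp
    qed simp
  qed auto
  ultimately show ?thesis using that M by blast
qed

end

text \<open>Dividing by \<open>s 0\<close> reduces to probability measures. If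
  \<open>s 0 = 0\<close>, all quadrature weights vanish, so every moment is 0 and the zero measure
  represents the sequence.\<close>

theorem stieltjes_moment_seq_if_psd:
  assumes "psd_seq s" "psd_seq (\<lambda>n. s (Suc n))"
  shows "stieltjes_moment_seq s"
proof -
  interpret positive_moment_functional s using assms by unfold_locales
  show ?thesis
  proof (cases "s 0 = 0")
    case True
    then have s: "s n = 0" for n by (rule zero_if_first_zero)
    let ?\<mu> = "density lborel (\<lambda>_. ennreal 0)"
    have "integrable ?\<mu> f \<and> integral\<^sup>L ?\<mu> f = 0"
      if "f \<in> borel_measurable borel" for f :: "real \<Rightarrow> real"
      using that integrable_density[of f lborel "\<lambda>_. 0"] integral_density[of f lborel "\<lambda>_. 0"] by simp
    then show ?thesis
      unfolding stieltjes_moment_seq_def set_integrable_def set_lebesgue_integral_def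
      by (intro exI[of _ ?\<mu>]) (simp add: s)
  next
    case False
    then have s0: "0 < s 0" using moment_nonneg[of 0] by simp
    have psd_scale: "psd_seq (\<lambda>n. f n / s 0)" if "psd_seq f" for f
    proof -
      have "0 \<le> (\<Sum>i<n. \<Sum>j<n. c i * c j * f (i + j)) / s 0" for n c
        using that s0 by (auto simp: psd_seq_def)
      then show ?thesis by (simp add: psd_seq_def sum_divide_distrib)
    qed
    interpret m: positive_moment_functional "\<lambda>n. s n / s 0"
      using assms by unfold_locales (auto intro: psd_scale)
    obtain M where M: "real_distribution M" and pos: "AE x in M. 0 \<le> x"
      and mom: "\<And>n. has_bochner_integral M (\<lambda>x. (max x 0) ^ n) (s n / s 0)"
      using m.stieltjes_normalised s0 by auto
    interpret M: real_distribution M by (rule M)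
    let ?\<mu> = "density M (\<lambda>_. ennreal (s 0))"
    have "has_bochner_integral M (\<lambda>x. s 0 * (indicator {0..} x * x ^ n)) (s n)" for n
    proof -
      have "has_bochner_integral M (\<lambda>x. indicator {0..} x * x ^ n) (s n / s 0)"
      proof (rule has_bochner_integralI_AE[OF mom])
        show "AE x in M. (max x 0) ^ n = indicator {0..} x * x ^ n"
          using pos by eventually_elim auto
      qed auto
      then have "has_bochner_integral M (\<lambda>x. s 0 * (indicator {0..} x * x ^ n)) (s 0 * (s n / s 0))"
        by (rule has_bochner_integral_mult_right)
      then show ?thesis using s0 by simp
    qed
    then have "integrable ?\<mu> (\<lambda>x. indicator {0..} x * x ^ n)"
      "integral\<^sup>L ?\<mu> (\<lambda>x. indicator {0..} x * x ^ n) = s n" for n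
      using s0 by (simp_all add: integrable_density integral_density has_bochner_integral_iff)
    then show ?thesis
      unfolding stieltjes_moment_seq_def set_integrable_def set_lebesgue_integral_def
      by (intro exI[of _ ?\<mu>]) simp
  qed
qed

lemma preserves_stieltjes_J_mat:
  assumes "nonneg_real.pos_params P"
  shows "preserves_stieltjes (J_mat P)"
  unfolding preserves_stieltjes_def
  using psd_seq_J_convolution[OF assms] stieltjes_moment_seq_if_psd by blast

theorem theorem4p4:
  shows "coeff_totally_positive (lower_mult (J_mat P8) (binomial_mat q8))
    \<and> (coeff_hankel_totally_positive (J_row P8 q8) \<and> coeff_log_convex 3 (J_row P8 q8)
       \<and> coeff_hankel_totally_positive (J_row_rev P8 q8) \<and> coeff_log_convex 3 (J_row_rev P8 q8))
    \<and> (coeff_hankel_totally_positive (\<lambda>n. J_mat P7 n 0) \<and> coeff_log_convex 3 (\<lambda>n. J_mat P7 n 0))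
    \<and> (\<forall>a b c u v x y :: real.
         0 \<le> a \<longrightarrow> 0 \<le> b \<longrightarrow> 0 \<le> c \<longrightarrow> 0 \<le> u \<longrightarrow> 0 \<le> v \<longrightarrow> 0 \<le> x \<longrightarrow> 0 \<le> y \<longrightarrow>
         preserves_stieltjes
           (J_mat \<lparr>pa = a, pb = b, pc = c, pu = u, pv = v, px = x, py = y\<rparr>))"
proof (intro conjI allI impI)
  note P = pos_params_indet_params and q = nonneg_coeffs_indet[of Vq]
  show "coeff_totally_positive (lower_mult (J_mat P8) (binomial_mat q8))"
    unfolding coeff_totally_positive_iff by (rule mpol.tp_J_binomial[OF P q])
  show "coeff_hankel_totally_positive (J_row P8 q8)" "coeff_log_convex 3 (J_row P8 q8)"
    by (rule hankel_tp_imp_coeff_positive, rule mpol.hankel_tp_J_row[OF P q])+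
  show "coeff_hankel_totally_positive (J_row_rev P8 q8)" "coeff_log_convex 3 (J_row_rev P8 q8)"
    using mpol.hankel_tp_J_row[OF mpol.pos_params_scale_params[OF P q] mpol.pos_1]
    by (simp_all add: hankel_tp_imp_coeff_positive J_row_rev_eq_J_row)
  show "coeff_hankel_totally_positive (\<lambda>n. J_mat P7 n 0)" "coeff_log_convex 3 (\<lambda>n. J_mat P7 n 0)"
    using mpol.hankel_tp_J_row[OF P[of "\<lambda>w. w"] mpol.pos_0]
    by (simp_all add: hankel_tp_imp_coeff_positive J_row_0)
next
  fix a b c u v x y :: real
  assume "0 \<le> a" "0 \<le> b" "0 \<le> c" "0 \<le> u" "0 \<le> v" "0 \<le> x" "0 \<le> y"
  then show "preserves_stieltjes
      (J_mat \<lparr>pa = a, pb = b, pc = c, pu = u, pv = v, px = x, py = y\<rparr>)"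
    by (intro preserves_stieltjes_J_mat) (simp add: nonneg_real.pos_params_def)
qed

end
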